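(* Let $d\ge1$ and $r_i,s_i>0$ for $i=1,\dots,d$. 1) For any $\lambda\in(0,\infty)^d$, the Kullback–Leibler risk of $p_{\mathrm J}(y\mid x)$ at $\lambda$ is less than $0.52\sum_{i=1}^d\log\bigl((r_i+s_i)/r_i\bigr)$. 2) For any predictive distribution $q(y\mid x)$ and any $\epsilon>0$, there exists $\lambda\in(0,\infty)^d$ such that the Kullback–Leibler risk of $q(y\mid x)$ at $\lambda$ is greater than $0.5\sum_{i=1}^d\log\bigl((r_i+s_i)/r_i\bigr)-\epsilon$.
   Context: $\mathbb{N}=\{0,1,2,\dots\}$. Model: for unknown $\lambda\in(0,\infty)^d$ and known $r_i,s_i>0$, $x$ and $y$ are independent with $p(x\mid\lambda)=\prod_{i=1}^d (r_i\lambda_i)^{x_i}e^{-r_i\lambda_i}/x_i!$ and $p(y\mid\lambda)=\prod_{i=1}^d (s_i\lambda_i)^{y_i}e^{-s_i\lambda_i}/y_i!$, $x,y\in\mathbb{N}^d$. A predictive distribution $q(y\mid x)$ assigns to each $x\in\mathbb{N}^d$ a probability distribution on $y\in\mathbb{N}^d$. Its Kullback–Leibler risk at $\lambda$ is $\sum_x p(x\mid\lambda)\sum_y p(y\mid\lambda)\log\frac{p(y\mid\lambda)}{q(y\mid x)}\in[0,\infty]$. The Jeffreys prior is $\pi_{\mathrm J}(\lambda)\propto\prod_{i=1}^d\lambda_i^{-1/2}$, and $p_{\mathrm J}(y\mid x)=\int p(x\mid\lambda)p(y\mid\lambda)\pi_{\mathrm J}(\lambda)\,\mathrm{d}\lambda\big/\int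 p(x\mid\lambda)\pi_{\mathrm J}(\lambda)\,\mathrm{d}\lambda$ is the corresponding Bayesian predictive distribution. *)

theory Defs
  imports "HOL-Probability.Probability"
begin

(* Sum over all of 'a of an extended-real family, as positive part minus negative part.
   It is the usual value as soon as one of the two parts is finite; for the families below the
   negative part is finite. *)
definition ext_sum :: "('a \<Rightarrow> ereal) \<Rightarrow> ereal" where
  "ext_sum f =
     enn2ereal (\<integral>\<^sup>+ x. e2ennreal (f x) \<partial>count_space UNIV) -
     enn2ereal (\<integral>\<^sup>+ x. e2ennreal (- f x) \<partial>count_space UNIV)"

(* a * log (a / b) with the conventions 0 * log (0 / b) = 0 and a * log (a / 0) = \<infinity> for a > 0. *)
definition kl_term :: "real \<Rightarrow> real \<Rightarrow> ereal" where
  "kl_term a b = (if a = 0 then 0 else if b = 0 then \<infinity> else ereal (a * ln (a / b)))"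

definition pos_orthant :: "(real ^ 'n) set" where
  "pos_orthant = {l. \<forall>i. 0 < l $ i}"

definition poisson_vec :: "real ^ 'n \<Rightarrow> real ^ 'n \<Rightarrow> nat ^ 'n \<Rightarrow> real" where
  "poisson_vec r l x =
     (\<Prod>i\<in>UNIV. (r $ i * l $ i) ^ (x $ i) * exp (- (r $ i * l $ i)) / fact (x $ i))"

definition kl_risk ::
  "real ^ 'n \<Rightarrow> real ^ 'n \<Rightarrow> (nat ^ 'n \<Rightarrow> nat ^ 'n \<Rightarrow> real) \<Rightarrow> real ^ 'n \<Rightarrow> ereal" where
  "kl_risk r s q l =
     ext_sum (\<lambda>x. ereal (poisson_vec r l x) * ext_sum (\<lambda>y. kl_term (poisson_vec s l y) (q x y)))"

(* The prior is improper; its normalisation is irrelevant since it cancels in jeffreys_predictive. *)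
definition jeffreys_prior :: "real ^ 'n \<Rightarrow> real" where
  "jeffreys_prior l = (\<Prod>i\<in>UNIV. (l $ i) powr (- 1 / 2))"

(* jeffreys_predictive r s x y is the predictive probability of y given x. *)
definition jeffreys_predictive ::
  "real ^ 'n \<Rightarrow> real ^ 'n \<Rightarrow> nat ^ 'n \<Rightarrow> nat ^ 'n \<Rightarrow> real" where
  "jeffreys_predictive r s x y =
     (LINT l:pos_orthant|lborel. poisson_vec r l x * poisson_vec s l y * jeffreys_prior l) /
     (LINT l:pos_orthant|lborel. poisson_vec r l x * jeffreys_prior l)"

end

(*
For a gamma prior the Bayesian predictive distribution is a product of negative binomials, and its
risk is a sum over the coordinates. Writing F m = E (ln (Gamma (X + 1/2))) - m ln m + m for X
Poisson with mean m, the Jeffreys coordinate risk is F (r l) - F ((r+s) l) + ln ((r+s)/r) / 2,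
and F' m = E (ln (X + 1/2)) - ln m.

Upper bound: it suffices that m F' m > -1/50. The function ln (n + 1/2) + 1 / (6 (2n+1)^2) has
increments at most 1/(n+1), whose Poisson mean is (1 - exp (-m)) / m; integrating from infinity
gives m F' m >= m exp (-m) / (m+1) - E (X / (6 (2X-1)^2)), where the last mean is elementary.

Lower bound: F' m <= m powr (-5/4), so F (r l) - F ((r+s) l) >= - 4 (r l) powr (-1/4). Averaging
over the proper prior prod l_i powr (-1/2) exp (-b l_i), the error term is of order b powr (1/4),
and b tends to 0.
*)
theory Submission
  imports Defs
begin

section \<open>Poisson means of exponentially bounded functions\<close>

text \<open>The shift 1/2 in F comes from the exponent of the Jeffreys prior and makes both halves
  possible: E (ln (X + c)) - ln m behaves like (c - 1/2) / m for large m, so only c = 1/2 makes the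
  derivative of F integrable at infinity. The leading risk of a coordinate is then half of its
  logarithm, and 0.52 is 1/2 + 1/50.

  The exponent -5/4 is a compromise. Near 0 the derivative of F is at most 1 / (2 m), at infinity it
  is of order m powr (-2), so up to constants every exponent -1 - d with 0 < d \<le> 1 bounds it
  from above. The primitive m powr (-d) must also be integrable near 0 against l powr (-1/2), which
  forces d < 1/2; the choice is d = 1/4.

  In the lower bound the obstacle is that q is arbitrary: its risk may be infinite and its
  logarithms have no fixed sign. The quantity that is averaged over the prior is therefore a
  nonnegative likelihood ratio, and the factor exp (-b l) only serves to make the total prior mass
  finite.\<close>

definition exp_bounded :: "(nat \<Rightarrow> real) \<Rightarrow> bool" where
  "exp_bounded \<phi> \<longleftrightarrow> (\<exists>C. \<forall>n. \<bar>\<phi> n\<bar> \<le> C * 2 ^ n)"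

text \<open>As a power series the mean is defined for every real \<mu> and can be differentiated
  termwise; \<open>poisson_pmf_expectation\<close> identifies it with an expectation for \<mu> > 0.
  The base 2 in \<open>exp_bounded\<close> is arbitrary: any geometric bound is beaten by the
  factorial, and the class is closed under shifts and Poisson averaging.\<close>

definition poisson_mean :: "(nat \<Rightarrow> real) \<Rightarrow> real \<Rightarrow> real" where
  "poisson_mean \<phi> \<mu> = exp (- \<mu>) * (\<Sum>n. \<phi> n / fact n * \<mu> ^ n)"

lemma exp_boundedI: "(\<And>n. \<bar>\<phi> n\<bar> \<le> C * 2 ^ n) \<Longrightarrow> exp_bounded \<phi>"
  by (auto simp: exp_bounded_def)

lemma exp_bounded_le:
  assumes "exp_bounded \<psi>" "\<And>n. \<bar>\<phi> n\<bar> \<le> \<bar>\<psi> n\<bar>"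
  shows "exp_bounded \<phi>"
  using assms unfolding exp_bounded_def by (meson order_trans)

lemma exp_bounded_const [intro]: "exp_bounded (\<lambda>n. c)"
  by (rule exp_boundedI[where C = "\<bar>c\<bar>"]) (simp add: mult_le_cancel_left1)

lemma exp_bounded_add [intro]:
  assumes "exp_bounded \<phi>" "exp_bounded \<psi>"
  shows "exp_bounded (\<lambda>n. \<phi> n + \<psi> n)"
proof -
  obtain C D where "\<And>n. \<bar>\<phi> n\<bar> \<le> C * 2 ^ n" "\<And>n. \<bar>\<psi> n\<bar> \<le> D * 2 ^ n"
    using assms by (auto simp: exp_bounded_def)
  then have "\<bar>\<phi> n + \<psi> n\<bar> \<le> (C + D) * 2 ^ n" for n
    using abs_triangle_ineq[of "\<phi> n" "\<psi> n"] by (smt (verit) distrib_right)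
  then show ?thesis by (rule exp_boundedI)
qed

lemma exp_bounded_cmult [intro]:
  assumes "exp_bounded \<phi>"
  shows "exp_bounded (\<lambda>n. c * \<phi> n)"
proof -
  obtain C where C: "\<And>n. \<bar>\<phi> n\<bar> \<le> C * 2 ^ n"
    using assms by (auto simp: exp_bounded_def)
  then have "\<bar>c * \<phi> n\<bar> \<le> (\<bar>c\<bar> * C) * 2 ^ n" for n
    using mult_left_mono[OF C, of "\<bar>c\<bar>" n] by (simp add: abs_mult mult.assoc)
  then show ?thesis by (rule exp_boundedI)
qed

lemma exp_bounded_diff [intro]:
  "exp_bounded \<phi> \<Longrightarrow> exp_bounded \<psi> \<Longrightarrow> exp_bounded (\<lambda>n. \<phi> n - \<psi> n)"
  using exp_bounded_add[OF _ exp_bounded_cmult[of \<psi> "-1"], of \<phi>] by simp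

lemma exp_bounded_shift [intro]:
  assumes "exp_bounded \<phi>"
  shows "exp_bounded (\<lambda>n. \<phi> (m + n))"
proof -
  obtain C where C: "\<And>n. \<bar>\<phi> n\<bar> \<le> C * 2 ^ n"
    using assms by (auto simp: exp_bounded_def)
  then have "\<bar>\<phi> (m + n)\<bar> \<le> (C * 2 ^ m) * 2 ^ n" for n
    using C[of "m + n"] by (simp add: power_add mult_ac)
  then show ?thesis by (rule exp_boundedI)
qed

lemma exp_bounded_Suc [intro]: "exp_bounded \<phi> \<Longrightarrow> exp_bounded (\<lambda>n. \<phi> (Suc n))"
  using exp_bounded_shift[of \<phi> 1] by simp

section \<open>Growth of monomials and bounded functions\<close>

lemma exp_bounded_of_nat: "exp_bounded (\<lambda>n. real n)"
  using less_imp_le[OF of_nat_less_two_power] by (intro exp_boundedI[where C = 1]) simp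

lemma exp_bounded_of_nat_power2: "exp_bounded (\<lambda>n. real n ^ 2)"
proof (rule exp_boundedI[where C = 2])
  fix n :: nat
  have "n ^ 2 \<le> 2 * 2 ^ n"
  proof (cases "n < 4")
    case True
    then have "n \<in> {0, 1, 2, 3}" by auto
    then show ?thesis by auto
  next
    case False
    then have "4 \<le> n" by simp
    then have "n ^ 2 \<le> 2 ^ n"
    proof (induction n rule: dec_induct)
      case (step n)
      have "n * 4 \<le> n * n" using step by simp
      then have "(Suc n) ^ 2 \<le> 2 * n ^ 2"
        using step(1) by (simp add: power2_eq_square) (use \<open>n * 4 \<le> n * n\<close> step(1) in linarith)
      then show ?case using step by simp
    qed simp
    then show ?thesis by simp
  qed
  then have "real (n ^ 2) \<le> real (2 * 2 ^ n)" by (rule of_nat_mono)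
  then show "\<bar>real n ^ 2\<bar> \<le> 2 * 2 ^ n" by simp
qed

lemma exp_bounded_of_nat_power3: "exp_bounded (\<lambda>n. real n ^ 3)"
proof (rule exp_boundedI[where C = 6])
  fix n :: nat
  have "n ^ 3 \<le> 6 * 2 ^ n"
  proof (induction n rule: less_induct)
    case (less n)
    show ?case
    proof (cases "n < 5")
      case True
      then have "n \<in> {0, 1, 2, 3, 4}" by auto
      then show ?thesis by auto
    next
      case False
      then obtain k where n: "n = Suc (4 + k)"
        by (metis Suc_numeral add_Suc le_Suc_ex linorder_not_less semiring_norm(5))
      \<comment> \<open>From 4 on, the ratio of consecutive cubes is at most 125/64 < 2, so the cube
        grows no faster than the power of 2.\<close>
      have "(Suc (4 + k)) ^ 3 \<le> 2 * (4 + k) ^ 3"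
        by (simp add: power3_eq_cube algebra_simps)
      also have "(4 + k) ^ 3 \<le> 6 * 2 ^ (4 + k)"
        by (rule less) (simp add: n)
      finally have "(Suc (4 + k)) ^ 3 \<le> 2 * (6 * 2 ^ (4 + k))" by simp
      then show ?thesis unfolding n by (simp only: power_Suc mult_ac)
    qed
  qed
  then have "real (n ^ 3) \<le> real (6 * 2 ^ n)" by (rule of_nat_mono)
  then show "\<bar>real n ^ 3\<bar> \<le> 6 * 2 ^ n" by simp
qed

lemma exp_bounded_bounded: "(\<And>n. \<bar>\<phi> n\<bar> \<le> c) \<Longrightarrow> exp_bounded \<phi>"
  by (rule exp_bounded_le[OF exp_bounded_const[of c]]) (meson abs_ge_self order_trans)

section \<open>Convergence, linearity and monotonicity of the Poisson mean\<close>

lemma poisson_mean_summable_abs: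
  assumes "exp_bounded \<phi>"
  shows "summable (\<lambda>n. \<bar>\<phi> n / fact n * \<mu> ^ n\<bar>)"
proof -
  obtain C where C: "\<And>n. \<bar>\<phi> n\<bar> \<le> C * 2 ^ n"
    using assms by (auto simp: exp_bounded_def)
  have "summable (\<lambda>n. C * (inverse (fact n) * (2 * \<bar>\<mu>\<bar>) ^ n))"
    by (intro summable_mult summable_exp)
  then show ?thesis
  proof (rule summable_comparison_test'[where N = 0])
    fix n :: nat
    have "\<bar>\<phi> n\<bar> / fact n * \<bar>\<mu>\<bar> ^ n \<le> C * 2 ^ n / fact n * \<bar>\<mu>\<bar> ^ n"
      by (intro mult_right_mono divide_right_mono C) auto
    then show "norm \<bar>\<phi> n / fact n * \<mu> ^ n\<bar> \<le> C * (inverse (fact n) * (2 * \<bar>\<mu>\<bar>) ^ n)"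
      by (simp add: abs_mult power_abs power_mult_distrib field_simps)
  qed
qed

lemma poisson_mean_summable:
  "exp_bounded \<phi> \<Longrightarrow> summable (\<lambda>n. \<phi> n / fact n * \<mu> ^ n)"
  by (rule summable_rabs_cancel) (rule poisson_mean_summable_abs)

lemma poisson_mean_add:
  "exp_bounded \<phi> \<Longrightarrow> exp_bounded \<psi> \<Longrightarrow>
    poisson_mean (\<lambda>n. \<phi> n + \<psi> n) \<mu> = poisson_mean \<phi> \<mu> + poisson_mean \<psi> \<mu>"
  unfolding poisson_mean_def add_divide_distrib distrib_right
  by (subst suminf_add[symmetric, OF poisson_mean_summable poisson_mean_summable])
     (assumption+, rule distrib_left)

lemma poisson_mean_cmult:
  "exp_bounded \<phi> \<Longrightarrow> poisson_mean (\<lambda>n. c * \<phi> n) \<mu> = c * poisson_mean \<phi> \<mu>"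
  unfolding poisson_mean_def
  using suminf_mult[OF poisson_mean_summable, of \<phi> c \<mu>] by (simp add: mult_ac)

lemma poisson_mean_diff:
  "exp_bounded \<phi> \<Longrightarrow> exp_bounded \<psi> \<Longrightarrow>
    poisson_mean (\<lambda>n. \<phi> n - \<psi> n) \<mu> = poisson_mean \<phi> \<mu> - poisson_mean \<psi> \<mu>"
  using poisson_mean_add[of \<phi> "\<lambda>n. -1 * \<psi> n" \<mu>] poisson_mean_cmult[of \<psi> "-1" \<mu>]
  by (simp add: exp_bounded_cmult[of \<psi> "-1", simplified])

lemma poisson_mean_indicator: "poisson_mean (\<lambda>n. of_bool (n = k)) \<mu> = exp (- \<mu>) * \<mu> ^ k / fact k"
proof -
  have "(\<Sum>n. of_bool (n = k) / fact n * \<mu> ^ n) = (\<Sum>n\<in>{k}. of_bool (n = k) / fact n * \<mu> ^ n)"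
    by (rule suminf_finite) auto
  then show ?thesis by (simp add: poisson_mean_def)
qed

lemma poisson_mean_const: "poisson_mean (\<lambda>n. c) \<mu> = c"
proof -
  have "(\<Sum>n. 1 / fact n * \<mu> ^ n) = exp \<mu>"
    by (simp add: exp_def divide_inverse mult.commute)
  then have "poisson_mean (\<lambda>n. 1) \<mu> = 1"
    unfolding poisson_mean_def by (simp add: exp_minus)
  then show ?thesis using poisson_mean_cmult[of "\<lambda>_. 1" c \<mu>] by auto
qed

lemma poisson_mean_mono:
  assumes "exp_bounded \<phi>" "exp_bounded \<psi>" "\<And>n. \<phi> n \<le> \<psi> n" "0 \<le> \<mu>"
  shows "poisson_mean \<phi> \<mu> \<le> poisson_mean \<psi> \<mu>"
  unfolding poisson_mean_def using assms
  by (intro mult_left_mono suminf_le poisson_mean_summable mult_right_mono divide_right_mono) auto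

text \<open>The Stein-Chen identity: the factor n cancels against the factorial and the index moves
  by one. Truncated subtraction at n = 0 is harmless because of the factor n. The moments below and
  the means of 1 / (n + 1) and similar fractions all come from it.\<close>

lemma poisson_mean_shift:
  assumes "exp_bounded (\<lambda>n. real n * \<phi> (n - 1))"
  shows "\<mu> * poisson_mean \<phi> \<mu> = poisson_mean (\<lambda>n. real n * \<phi> (n - 1)) \<mu>"
proof -
  let ?a = "\<lambda>n. (real n * \<phi> (n - 1)) / fact n * \<mu> ^ n"
  have Suc: "?a (Suc n) = \<mu> * (\<phi> n / fact n * \<mu> ^ n)" for n
    by (simp add: field_simps del: of_nat_Suc)
  have "suminf ?a = (\<Sum>n. ?a (Suc n))"
    using suminf_split_head[OF poisson_mean_summable[OF assms, of \<mu>]] by simp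
  then have *: "suminf ?a = (\<Sum>n. \<mu> * (\<phi> n / fact n * \<mu> ^ n))"
    unfolding Suc .
  have "summable (\<lambda>n. \<mu> * (\<phi> n / fact n * \<mu> ^ n))"
    using poisson_mean_summable[OF assms, of \<mu>] unfolding Suc[symmetric]
    by (subst summable_Suc_iff)
  \<comment> \<open>Summability of the scaled series returns that of the unscaled one only for \<mu>
    \<noteq> 0; for \<mu> = 0 both sides vanish.\<close>
  then have "(\<Sum>n. \<mu> * (\<phi> n / fact n * \<mu> ^ n)) = \<mu> * (\<Sum>n. \<phi> n / fact n * \<mu> ^ n)"
    using suminf_mult[of "\<lambda>n. \<phi> n / fact n * \<mu> ^ n" \<mu>]
    by (cases "\<mu> = 0") (auto simp only: summable_cmult_iff mult_zero_left suminf_zero)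
  with * show ?thesis by (simp add: poisson_mean_def)
qed

lemma poisson_mean_of_nat: "poisson_mean (\<lambda>n. real n) \<mu> = \<mu>"
  using poisson_mean_shift[of "\<lambda>_. 1" \<mu>] exp_bounded_of_nat by (simp add: poisson_mean_const)

lemma poisson_mean_of_nat_power2: "poisson_mean (\<lambda>n. real n ^ 2) \<mu> = \<mu> ^ 2 + \<mu>"
proof -
  have eq: "(\<lambda>n. real n * (real (n - 1) + 1)) = (\<lambda>n. real n ^ 2)"
    by (rule ext, case_tac n) (auto simp: power2_eq_square)
  have "\<mu> * poisson_mean (\<lambda>n. real n + 1) \<mu> = poisson_mean (\<lambda>n. real n ^ 2) \<mu>"
    using poisson_mean_shift[of "\<lambda>n. real n + 1" \<mu>] exp_bounded_of_nat_power2 unfolding eq by simp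
  moreover have "poisson_mean (\<lambda>n. real n + 1) \<mu> = \<mu> + 1"
    by (subst poisson_mean_add) (auto simp: poisson_mean_of_nat poisson_mean_const exp_bounded_of_nat)
  ultimately show ?thesis by (simp add: power2_eq_square algebra_simps)
qed

lemma poisson_mean_of_nat_power3:
  "poisson_mean (\<lambda>n. real n ^ 3) \<mu> = \<mu> ^ 3 + 3 * \<mu> ^ 2 + \<mu>"
proof -
  have eq: "(\<lambda>n. real n * (real (n - 1) ^ 2 + (2 * real (n - 1) + 1))) = (\<lambda>n. real n ^ 3)"
    by (rule ext, case_tac n) (auto simp: power2_eq_square power3_eq_cube algebra_simps)
  have "\<mu> * poisson_mean (\<lambda>n. real n ^ 2 + (2 * real n + 1)) \<mu> = poisson_mean (\<lambda>n. real n ^ 3) \<mu>"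
    using poisson_mean_shift[of "\<lambda>n. real n ^ 2 + (2 * real n + 1)" \<mu>] exp_bounded_of_nat_power3
    unfolding eq by simp
  moreover have "poisson_mean (\<lambda>n. real n ^ 2 + (2 * real n + 1)) \<mu> = \<mu> ^ 2 + \<mu> + (2 * \<mu> + 1)"
    by (simp add: poisson_mean_add poisson_mean_cmult poisson_mean_of_nat poisson_mean_of_nat_power2
        poisson_mean_const exp_bounded_of_nat exp_bounded_of_nat_power2 exp_bounded_const
        exp_bounded_add exp_bounded_cmult)
  ultimately show ?thesis by (simp add: power2_eq_square power3_eq_cube algebra_simps)
qed

lemma poisson_mean_inverse_Suc: "\<mu> * poisson_mean (\<lambda>n. 1 / (real n + 1)) \<mu> = 1 - exp (- \<mu>)"
proof -
  have eq: "(\<lambda>n. real n * (1 / (real (n - 1) + 1))) = (\<lambda>n. 1 - of_bool (n = 0))"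
    by (rule ext, case_tac n) auto
  have b: "exp_bounded (\<lambda>n. of_bool (n = (0::nat)))"
    by (rule exp_bounded_bounded[where c = 1]) auto
  then have "\<mu> * poisson_mean (\<lambda>n. 1 / (real n + 1)) \<mu> = poisson_mean (\<lambda>n. 1 - of_bool (n = 0)) \<mu>"
    using poisson_mean_shift[of "\<lambda>n. 1 / (real n + 1)" \<mu>] exp_bounded_diff[OF exp_bounded_const b]
    unfolding eq by simp
  also have "\<dots> = 1 - exp (- \<mu>)"
    using b by (subst poisson_mean_diff) (auto simp: poisson_mean_const poisson_mean_indicator)
  finally show ?thesis .
qed

text \<open>Termwise differentiation shifts the coefficients by one, and differentiating exp (-
  \<mu>) subtracts the mean itself. A derivative in \<mu> thus becomes a forward difference, which
  turns \<open>ln_Gamma_half\<close> into a logarithm and \<open>ln_half_corr\<close> into something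
  comparable with 1 / (n + 1).\<close>

lemma poisson_mean_deriv:
  assumes "exp_bounded \<phi>"
  shows "(poisson_mean \<phi> has_real_derivative poisson_mean (\<lambda>n. \<phi> (Suc n) - \<phi> n) \<mu>) (at \<mu>)"
proof -
  let ?S = "\<lambda>\<phi> \<mu>. \<Sum>n. \<phi> n / fact n * \<mu> ^ n :: real"
  have "((\<lambda>x. \<Sum>n. (\<phi> n / fact n) * x ^ n) has_real_derivative
      (\<Sum>n. diffs (\<lambda>n. \<phi> n / fact n) n * \<mu> ^ n)) (at \<mu>)"
    by (rule termdiffs_strong_converges_everywhere) (rule poisson_mean_summable[OF assms])
  moreover have "diffs (\<lambda>n. \<phi> n / fact n) n = \<phi> (Suc n) / fact n" for n
    by (simp add: diffs_def field_simps del: of_nat_Suc)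
  ultimately have "(?S \<phi> has_real_derivative ?S (\<lambda>n. \<phi> (Suc n)) \<mu>) (at \<mu>)"
    by simp
  then have "(poisson_mean \<phi> has_real_derivative
      exp (-\<mu>) * ?S (\<lambda>n. \<phi> (Suc n)) \<mu> - exp (-\<mu>) * ?S \<phi> \<mu>) (at \<mu>)"
    unfolding poisson_mean_def
    by (rule DERIV_cong[OF DERIV_mult[OF DERIV_chain2[OF DERIV_exp DERIV_minus[OF DERIV_ident]]]]) simp
  then show ?thesis
    using poisson_mean_diff[OF exp_bounded_Suc[OF assms] assms, of \<mu>] by (simp add: poisson_mean_def)
qed

section \<open>The Poisson mean of the logarithm\<close>

text \<open>The left side is 2 artanh u, and 2/3 is its cubic Taylor coefficient. The denominator of
  the error term is chosen so that for u = 1 / (2 (n + 1)) the term is exactly the decrease of the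
  correction in \<open>ln_half_corr\<close> from n to n + 1. The proof compares derivatives, both
  sides being 0 at u = 0.\<close>

lemma ln_quotient_le:
  fixes u :: real
  assumes "0 \<le> u" "u < 1"
  shows "ln ((1 + u) / (1 - u)) \<le> 2 * u + 2 / 3 * u ^ 3 / (1 - u\<^sup>2)\<^sup>2"
proof -
  let ?f = "\<lambda>u. 2 * u + 2 / 3 * (u ^ 3 / (1 - u\<^sup>2)\<^sup>2) - (ln (1 + u) - ln (1 - u)) :: real"
  have "?f 0 \<le> ?f u"
  proof (rule DERIV_nonneg_imp_nondecreasing[OF assms(1)])
    fix x :: real assume x: "0 \<le> x" "x \<le> u"
    define w where "w = 1 - x\<^sup>2"
    have w: "0 < w" "w \<le> 1"
      using x assms by (auto simp: w_def abs_square_less_1)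
    have eq: "(1 + x) * (1 - x) = w" by (simp add: w_def power2_eq_square algebra_simps)
    have "(?f has_real_derivative
        2 + 2 / 3 * ((3 * x\<^sup>2 * w\<^sup>2 - x ^ 3 * (2 * w * (- (2 * x)))) / (w\<^sup>2 * w\<^sup>2))
         - (1 / (1 + x) + 1 / (1 - x))) (at x)"
      unfolding w_def using x assms w(1)
      by (auto intro!: derivative_eq_intros simp: w_def)
         (use w in \<open>simp add: w_def divide_simps eval_nat_numeral\<close>; simp add: algebra_simps)
    moreover have "1 / (1 + x) + 1 / (1 - x) = 2 / w"
      unfolding eq[symmetric] using x assms by (simp add: divide_simps)
    moreover have "(3 * x\<^sup>2 * w\<^sup>2 - x ^ 3 * (2 * w * (- (2 * x)))) / (w\<^sup>2 * w\<^sup>2)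
        = (3 * x\<^sup>2 * w + 4 * x ^ 4) / w ^ 3"
      using w by (simp add: field_simps eval_nat_numeral)
    moreover have "2 / w = 2 + 2 * x\<^sup>2 / w"
      using w by (simp add: w_def field_simps)
    moreover have "2 * x\<^sup>2 / w \<le> 2 / 3 * ((3 * x\<^sup>2 * w + 4 * x ^ 4) / w ^ 3)"
    proof -
      have "2 * x\<^sup>2 / w = 2 / 3 * ((3 * x\<^sup>2 * w * w) / w ^ 3)"
        using w by (simp add: field_simps eval_nat_numeral)
      also have "\<dots> \<le> 2 / 3 * ((3 * x\<^sup>2 * w + 4 * x ^ 4) / w ^ 3)"
      proof (intro mult_left_mono divide_right_mono)
        have "3 * x\<^sup>2 * w * w \<le> 3 * x\<^sup>2 * w * 1" using w by (intro mult_left_mono) auto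
        moreover have "0 \<le> 4 * x ^ 4" by simp
        ultimately show "3 * x\<^sup>2 * w * w \<le> 3 * x\<^sup>2 * w + 4 * x ^ 4" by linarith
      qed (use w in auto)
      finally show ?thesis .
    qed
    ultimately show "\<exists>y. (?f has_real_derivative y) (at x) \<and> 0 \<le> y"
      by (intro exI conjI) (assumption, linarith)
  qed
  then show ?thesis using assms by (simp add: ln_div)
qed

lemma exp_bounded_ln_half: "exp_bounded (\<lambda>n. ln (real n + 1 / 2))"
proof (rule exp_bounded_le)
  show "exp_bounded (\<lambda>n. real n + 1)" using exp_bounded_of_nat by auto
  fix n
  have "ln (real n + 1 / 2) \<le> real n + 1 / 2 - 1" by (intro ln_le_minus_one) auto
  moreover have "ln (1 / 2) \<le> ln (real n + 1 / 2)" by simp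
  moreover have "ln (inverse (1 / 2)) \<le> inverse (1 / 2) - (1::real)" by (intro ln_le_minus_one) auto
  then have "- 1 \<le> ln (1 / 2 :: real)" by (simp add: ln_div)
  ultimately show "\<bar>ln (real n + 1 / 2)\<bar> \<le> \<bar>real n + 1\<bar>" by linarith
qed

text \<open>An upper approximation of the digamma function at \<^term>\<open>real n + 1\<close>. Its increments stay
  below those of the harmonic numbers, whose Poisson mean is known in closed form.\<close>

definition ln_half_corr :: "nat \<Rightarrow> real" where
  "ln_half_corr n = ln (real n + 1 / 2) + 1 / (6 * (2 * real n + 1)\<^sup>2)"

lemma inverse_square_bounds:
  "0 \<le> 1 / (6 * (2 * real n + 1)\<^sup>2)" "1 / (6 * (2 * real n + 1)\<^sup>2) \<le> 1"
proof -
  have "1 \<le> (2 * real n + 1)\<^sup>2" by (rule one_le_power) simp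
  then have "1 \<le> 6 * (2 * real n + 1)\<^sup>2" by linarith
  then show "1 / (6 * (2 * real n + 1)\<^sup>2) \<le> 1" by (simp add: divide_le_eq)
qed simp

lemma exp_bounded_inverse_square: "exp_bounded (\<lambda>n. 1 / (6 * (2 * real n + 1)\<^sup>2))"
  using inverse_square_bounds by (intro exp_bounded_bounded[where c = 1]) (simp only: abs_of_nonneg)

lemma exp_bounded_ln_half_corr: "exp_bounded ln_half_corr"
  unfolding ln_half_corr_def by (intro exp_bounded_add exp_bounded_ln_half exp_bounded_inverse_square)

text \<open>The correction is the second term of the expansion digamma (n + 1) = ln (n + 1/2) + 1 /
  (24 (n + 1/2)^2) - ..., and digamma itself has increments 1 / (n + 1).\<close>

lemma ln_half_corr_Suc: "ln_half_corr (Suc n) - ln_half_corr n \<le> 1 / (real n + 1)"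
proof -
  \<comment> \<open>The points n + 1/2 and n + 3/2 lie symmetrically about n + 1, so their quotient
    is (1 + u) / (1 - u) with u the relative half-distance.\<close>
  define u where "u = 1 / (2 * (real n + 1))"
  have u: "0 < u" "u \<le> 1 / 2" by (auto simp: u_def field_simps)
  have n: "real n + 1 = 1 / (2 * u)" by (simp add: u_def)
  have m: "2 * real n + 1 = (1 - u) / u" "2 * real (Suc n) + 1 = (1 + u) / u"
    using n u by (auto simp: field_simps)
  have h: "real n + 1 / 2 = (1 - u) / (2 * u)" "real (Suc n) + 1 / 2 = (1 + u) / (2 * u)"
    using n u by (auto simp: field_simps)
  have "ln (real (Suc n) + 1 / 2) - ln (real n + 1 / 2) = ln ((1 + u) / (1 - u))"
    unfolding h using u by (simp add: ln_div)
  also have "\<dots> \<le> 2 * u + 2 / 3 * u ^ 3 / (1 - u\<^sup>2)\<^sup>2"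
    using u by (intro ln_quotient_le) auto
  also have "2 / 3 * u ^ 3 / (1 - u\<^sup>2)\<^sup>2
      = 1 / (6 * ((1 - u) / u)\<^sup>2) - 1 / (6 * ((1 + u) / u)\<^sup>2)"
  proof -
    define a b where "a = 1 - u" and "b = 1 + u"
    have ab: "a \<noteq> 0" "b \<noteq> 0" using u by (auto simp: a_def b_def)
    have "b\<^sup>2 - a\<^sup>2 = 4 * u" by (simp add: a_def b_def power2_eq_square algebra_simps)
    have "1 / (6 * (a / u)\<^sup>2) - 1 / (6 * (b / u)\<^sup>2) = u\<^sup>2 * (b\<^sup>2 - a\<^sup>2) / (6 * (a * b)\<^sup>2)"
      using u ab by (simp add: field_simps)
    also have "\<dots> = 2 / 3 * u ^ 3 / (a * b)\<^sup>2"
      unfolding \<open>b\<^sup>2 - a\<^sup>2 = 4 * u\<close> by (simp add: power2_eq_square power3_eq_cube mult_ac)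
    also have "a * b = 1 - u\<^sup>2" by (simp add: a_def b_def power2_eq_square algebra_simps)
    finally show ?thesis by (simp add: a_def b_def)
  qed
  also have "2 * u = 1 / (real n + 1)" by (simp add: u_def divide_simps)
  finally show ?thesis unfolding ln_half_corr_def m by linarith
qed

text \<open>A crude bound that serves as the boundary value at infinity for the next lemma. It uses
  ln z \<ge> ln \<mu> + 1 - \<mu> / z at z = n + 1/2, with 1 / z replaced by fractions whose Poisson
  means \<open>poisson_mean_shift\<close> controls.\<close>

lemma poisson_mean_ln_half_ge:
  assumes "0 < \<mu>"
  shows "ln \<mu> - 2 / \<mu> \<le> poisson_mean (\<lambda>n. ln (real n + 1 / 2)) \<mu>"
proof -
  let ?g = "\<lambda>n. 1 / ((real n + 1) * (real n + 2))"
  have b1: "exp_bounded (\<lambda>n. 1 / (real n + 1))"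
    by (rule exp_bounded_bounded[where c = 1]) (auto simp: field_simps)
  have b2: "exp_bounded ?g"
  proof (rule exp_bounded_bounded[where c = 1])
    fix n
    have "1 * 1 \<le> (real n + 1) * (real n + 2)" by (rule mult_mono) auto
    then show "\<bar>?g n\<bar> \<le> 1" by (simp add: divide_le_eq)
  qed
  have b3: "exp_bounded (\<lambda>n. real n * (1 / ((real (n - 1) + 1) * (real (n - 1) + 2))))"
  proof (rule exp_bounded_bounded[where c = 1])
    fix n
    show "\<bar>real n * (1 / ((real (n - 1) + 1) * (real (n - 1) + 2)))\<bar> \<le> 1"
    proof (cases n)
      case (Suc m)
      have "1 + real m \<le> (real m + 1) * (real m + 2)"
        by (simp add: algebra_simps)
      then show ?thesis by (simp add: Suc divide_simps)
    qed simp
  qed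
  have i1: "\<mu> * poisson_mean (\<lambda>n. 1 / (real n + 1)) \<mu> \<le> 1"
    unfolding poisson_mean_inverse_Suc by simp
  have "\<mu> * poisson_mean ?g \<mu> =
      poisson_mean (\<lambda>n. real n * (1 / ((real (n - 1) + 1) * (real (n - 1) + 2)))) \<mu>"
    by (rule poisson_mean_shift[OF b3])
  also have "\<dots> \<le> poisson_mean (\<lambda>n. 1 / (real n + 1)) \<mu>"
  proof (intro poisson_mean_mono b1 b3)
    fix n
    show "real n * (1 / ((real (n - 1) + 1) * (real (n - 1) + 2))) \<le> 1 / (real n + 1)"
      by (cases n) (auto simp: divide_simps algebra_simps)
  qed (use assms in auto)
  also have "\<dots> \<le> 1 / \<mu>" using i1 assms by (simp add: field_simps)
  finally have i2: "\<mu> * poisson_mean ?g \<mu> \<le> 1 / \<mu>" .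
  have "ln \<mu> - 2 / \<mu> \<le> (ln \<mu> + 1) - \<mu> * (poisson_mean (\<lambda>n. 1 / (real n + 1)) \<mu> + 2 * poisson_mean ?g \<mu>)"
    using i1 i2 by (simp add: algebra_simps)
  also have "\<dots> = poisson_mean (\<lambda>n. (ln \<mu> + 1) - \<mu> * (1 / (real n + 1) + 2 * ?g n)) \<mu>"
    by (simp only: poisson_mean_diff poisson_mean_cmult poisson_mean_add poisson_mean_const
        b1 b2 exp_bounded_const exp_bounded_cmult exp_bounded_add)
  also have "\<dots> \<le> poisson_mean (\<lambda>n. ln (real n + 1 / 2)) \<mu>"
  proof (rule poisson_mean_mono)
    show "exp_bounded (\<lambda>n. (ln \<mu> + 1) - \<mu> * (1 / (real n + 1) + 2 * ?g n))"
      by (intro exp_bounded_diff exp_bounded_cmult exp_bounded_add b1 b2 exp_bounded_const)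
    fix n
    have "ln (\<mu> / (real n + 1 / 2)) \<le> \<mu> / (real n + 1 / 2) - 1"
      using assms by (intro ln_le_minus_one) (auto intro!: divide_pos_pos)
    then have "ln \<mu> + 1 - \<mu> / (real n + 1 / 2) \<le> ln (real n + 1 / 2)"
      using assms by (simp add: ln_div)
    moreover have "1 / (real n + 1 / 2) \<le> 1 / (real n + 1) + 2 * ?g n"
      by (simp add: divide_simps) (simp add: algebra_simps)
    then have "\<mu> * (1 / (real n + 1 / 2)) \<le> \<mu> * (1 / (real n + 1) + 2 * ?g n)"
      using assms by (intro mult_left_mono) auto
    ultimately show "ln \<mu> + 1 - \<mu> * (1 / (real n + 1) + 2 * ?g n) \<le> ln (real n + 1 / 2)"
      by simp
  qed (use assms exp_bounded_ln_half in auto)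
  finally show ?thesis .
qed

text \<open>The derivative of the mean minus ln is at most - exp (- x) / x, which would give the
  exponential integral of exp (- t) / t from \<mu> to infinity. Its elementary minorant exp (-
  \<mu>) / (\<mu> + 1) suffices, since x (x + 2) \<le> (x + 1)^2 compares the derivatives.\<close>

lemma poisson_mean_ln_half_corr_ge:
  assumes "0 < \<mu>"
  shows "ln \<mu> + exp (- \<mu>) / (\<mu> + 1) \<le> poisson_mean ln_half_corr \<mu>"
proof (rule ccontr)
  let ?M = "\<lambda>\<mu>. poisson_mean ln_half_corr \<mu> - ln \<mu> - exp (- \<mu>) / (\<mu> + 1)"
  assume "\<not> ?thesis"
  then have neg: "?M \<mu> < 0" by simp
  \<comment> \<open>One far point replaces the limit at infinity: there ?M is at least -3 / \<nu> (2
    from the crude bound, 1 from the exponential term), while monotonicity would keep it at most -4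
    / \<nu>.\<close>
  define \<nu> where "\<nu> = max \<mu> (4 / (- ?M \<mu>))"
  have \<nu>: "\<mu> \<le> \<nu>" "4 / (- ?M \<mu>) \<le> \<nu>" "0 < \<nu>" using assms by (auto simp: \<nu>_def)
  have "?M \<nu> \<le> ?M \<mu>"
  proof (rule DERIV_nonpos_imp_nonincreasing[OF \<nu>(1)])
    fix x assume "\<mu> \<le> x" "x \<le> \<nu>"
    then have x: "0 < x" using assms by simp
    let ?d = "poisson_mean (\<lambda>n. ln_half_corr (Suc n) - ln_half_corr n) x"
    have "(?M has_real_derivative
        ?d - 1 / x - (- exp (- x) * (x + 1) - exp (- x) * 1) / ((x + 1) * (x + 1))) (at x)"
      using x by (auto intro!: derivative_eq_intros poisson_mean_deriv exp_bounded_ln_half_corr)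
    moreover have "?d - 1 / x - (- exp (- x) * (x + 1) - exp (- x) * 1) / ((x + 1) * (x + 1)) \<le> 0"
    proof -
      have "?d \<le> poisson_mean (\<lambda>n. 1 / (real n + 1)) x"
        using x
        by (intro poisson_mean_mono ln_half_corr_Suc exp_bounded_diff exp_bounded_Suc
            exp_bounded_ln_half_corr)
          (auto intro!: exp_bounded_bounded[where c = 1] simp: field_simps)
      also have "\<dots> = 1 / x - exp (- x) / x"
        using poisson_mean_inverse_Suc[of x] x by (simp add: field_simps)
      finally have "?d - 1 / x \<le> - (exp (- x) / x)" by simp
      moreover have "(- exp (- x) * (x + 1) - exp (- x) * 1) / ((x + 1) * (x + 1))
          = - exp (- x) * ((x + 2) / ((x + 1) * (x + 1)))"
        unfolding times_divide_eq_right by (rule arg_cong[where f = "\<lambda>y. y / _"]) (simp add: algebra_simps)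
      moreover have "(x + 2) / ((x + 1) * (x + 1)) \<le> 1 / x"
        using x by (simp add: divide_simps) (simp add: algebra_simps)
      then have "exp (- x) * ((x + 2) / ((x + 1) * (x + 1))) \<le> exp (- x) * (1 / x)"
        by (intro mult_left_mono) auto
      ultimately show ?thesis unfolding mult_minus_left by simp
    qed
    ultimately show "\<exists>y. (?M has_real_derivative y) (at x) \<and> y \<le> 0" by blast
  qed
  moreover have "- 3 / \<nu> \<le> ?M \<nu>"
  proof -
    have "poisson_mean (\<lambda>n. ln (real n + 1 / 2)) \<nu> \<le> poisson_mean ln_half_corr \<nu>"
      using \<nu>(3) inverse_square_bounds(1)
      by (intro poisson_mean_mono exp_bounded_ln_half exp_bounded_ln_half_corr)
        (auto simp: ln_half_corr_def)
    moreover have "exp (- \<nu>) / (\<nu> + 1) \<le> 1 / \<nu>" using \<nu>(3) by (intro frac_le) auto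
    ultimately show ?thesis using poisson_mean_ln_half_ge[OF \<nu>(3)] by (simp add: field_simps)
  qed
  moreover have "?M \<mu> < - 3 / \<nu>"
    using \<nu> neg by (simp add: field_simps)
  ultimately show False by linarith
qed

text \<open>What is left of \<open>poisson_mean_ln_half_gt\<close> after multiplication by exp x and
  replacement of exp x by its Taylor polynomial of degree 5. The constant 1/50 consists of 7/500,
  the tail bound of \<open>inverse_square_shift_le\<close>, and 3/500, the constant term of the
  scaled exponential.\<close>

lemma polynomial_bound:
  fixes x :: real
  assumes "0 < x"
  shows "x / 6 + x\<^sup>2 / 54 + x ^ 3 / 300 - 7 / 500 * (x + x\<^sup>2 / 2 + x ^ 3 / 6)
    < 3 / 500 * (x + x\<^sup>2 / 2 + x ^ 3 / 6 + x ^ 4 / 24 + x ^ 5 / 120) + 1 / 50 + x / (x + 1)"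
proof -
  have "0 < (x + 1) * (3 / 500 * (x + x\<^sup>2 / 2 + x ^ 3 / 6 + x ^ 4 / 24 + x ^ 5 / 120) + 1 / 50
     - (x / 6 + x\<^sup>2 / 54 + x ^ 3 / 300 - 7 / 500 * (x + x\<^sup>2 / 2 + x ^ 3 / 6))) + x"
    (is "0 < ?p")
  proof -
    \<comment> \<open>The polynomial ?p has constant term 1/50; q is the rest divided by x.\<close>
    define q where "q = 131 / 150 - 419 / 2700 * x - 23 / 2700 * x\<^sup>2 + x ^ 3 / 4000
      + 3 / 10000 * x ^ 4 + x ^ 5 / 20000"
    have "0 < q"
    proof (cases "x \<le> 4")
      case True
      have "x\<^sup>2 \<le> 4 * x" using True assms by (simp add: power2_eq_square)
      moreover have "0 < x ^ 3" "0 < x ^ 4" "0 < x ^ 5" using assms by auto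
      ultimately show ?thesis using True unfolding q_def by linarith
    next
      case False
      \<comment> \<open>Recentred at 4, q has a negative coefficient only at h, and (h - 1)^2 \<ge>
        0 absorbs that term into the quadratic and the constant one.\<close>
      define h where "h = x - 4"
      have x: "x = 4 + h" by (simp add: h_def)
      have "0 \<le> h" using False by (simp add: h_def)
      then have "0 \<le> h ^ 3" "0 \<le> h ^ 4" "0 \<le> h ^ 5" "0 \<le> h ^ 2" by auto
      moreover have "0 \<le> h ^ 2 - 2 * h + 1"
        using zero_le_power2[of "h - 1"] by (simp add: power2_eq_square algebra_simps)
      moreover have "q = 1757 / 6750 - 529 / 7500 * h + 7463 / 135000 * h ^ 2 + 261 / 20000 * h ^ 3 + 13 / 10000 * h ^ 4 + 1 / 20000 * h ^ 5"
        unfolding q_def x by (simp add: eval_nat_numeral field_simps)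
      ultimately show ?thesis by linarith
    qed
    moreover have "?p = 1 / 50 + x * q"
      by (simp add: q_def eval_nat_numeral field_simps)
    ultimately show ?thesis using assms by (simp add: add_pos_pos)
  qed
  moreover have "A < T + x / (x + 1)" if "0 < (x + 1) * (T - A) + x" for A T
    using that assms by (simp add: field_simps)
  ultimately show ?thesis by blast
qed

text \<open>The bound is exact at n = 0, 1, 2, 3, with values 0, 1/6, 1/27, 1/50. From 4 on the left
  side decreases from 2/147, which 7/500 rounds up. As a constant plus indicators, the bound has a
  Poisson mean made of four explicit weights.\<close>

lemma inverse_square_shift_le:
  "real n * (1 / (6 * (2 * real (n - 1) + 1)\<^sup>2)) \<le> 7 / 500
    + ((1 / 6 - 7 / 500) * of_bool (n = 1) + ((1 / 27 - 7 / 500) * of_bool (n = 2)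
    + ((1 / 50 - 7 / 500) * of_bool (n = 3) + - 7 / 500 * of_bool (n = 0))))"
proof (cases "n < 4")
  case True
  then have "n \<in> {0, 1, 2, 3}" by auto
  then show ?thesis by (auto simp: power2_eq_square)
next
  case False
  then obtain m where n: "n = 4 + m" using le_Suc_ex[of 4 n] by auto
  have "real n * 500 \<le> 7 * (6 * (2 * real (n - 1) + 1)\<^sup>2)"
    by (simp add: n power2_eq_square algebra_simps)
  moreover have "0 < 6 * (2 * real (n - 1) + 1)\<^sup>2" by simp
  ultimately have "real n / (6 * (2 * real (n - 1) + 1)\<^sup>2) \<le> 7 / 500" by (simp add: pos_divide_le_eq)
  then show ?thesis using n by simp
qed

lemma exp_ge_Taylor5:
  fixes x :: real
  assumes "0 \<le> x"
  shows "1 + x + x\<^sup>2 / 2 + x ^ 3 / 6 + x ^ 4 / 24 + x ^ 5 / 120 \<le> exp x"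
proof -
  have "(\<Sum>n<6. inverse (fact n) * x ^ n) \<le> (\<Sum>n. inverse (fact n) * x ^ n)"
    using assms by (intro sum_le_suminf summable_exp) auto
  then show ?thesis by (simp add: exp_def eval_nat_numeral fact_numeral scaleR_conv_of_real field_simps)
qed

text \<open>The gain exp (- \<mu>) / (\<mu> + 1) is essential: at \<mu> = 1 the loss from the
  correction term alone exceeds exp (-1) / 6, which is more than 1/50.\<close>

lemma poisson_mean_ln_half_gt:
  assumes "0 < \<mu>"
  shows "- 1 / 50 < \<mu> * (poisson_mean (\<lambda>n. ln (real n + 1 / 2)) \<mu> - ln \<mu>)"
proof -
  let ?i = "\<lambda>n. 1 / (6 * (2 * real n + 1)\<^sup>2)"
  let ?J = "\<lambda>n. real n * ?i (n - 1)"
  have bnd: "exp_bounded (\<lambda>n. of_bool (n = k))" for k :: nat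
    by (rule exp_bounded_bounded[where c = 1]) auto
  have bJ: "exp_bounded ?J"
  proof (rule exp_bounded_bounded[where c = 1])
    fix n
    have "?J n \<le> 1" using inverse_square_shift_le[of n] by (rule order_trans) (auto simp: of_bool_def)
    then show "\<bar>?J n\<bar> \<le> 1" by (simp only: abs_of_nonneg[OF mult_nonneg_nonneg] of_nat_0_le_iff inverse_square_bounds)
  qed
  have "\<mu> * poisson_mean ?i \<mu> = poisson_mean ?J \<mu>" by (rule poisson_mean_shift[OF bJ])
  also have "\<dots> \<le> poisson_mean (\<lambda>n. 7 / 500
    + ((1 / 6 - 7 / 500) * of_bool (n = 1) + ((1 / 27 - 7 / 500) * of_bool (n = 2)
    + ((1 / 50 - 7 / 500) * of_bool (n = 3) + - 7 / 500 * of_bool (n = 0))))) \<mu>"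
    using assms by (intro poisson_mean_mono bJ inverse_square_shift_le exp_bounded_add exp_bounded_cmult
        exp_bounded_const bnd) auto
  also have "\<dots> = 7 / 500 + ((1 / 6 - 7 / 500) * (exp (- \<mu>) * \<mu> ^ 1 / fact 1)
      + ((1 / 27 - 7 / 500) * (exp (- \<mu>) * \<mu> ^ 2 / fact 2)
      + ((1 / 50 - 7 / 500) * (exp (- \<mu>) * \<mu> ^ 3 / fact 3) + - 7 / 500 * (exp (- \<mu>) * \<mu> ^ 0 / fact 0))))"
    by (simp only: poisson_mean_add poisson_mean_cmult poisson_mean_const poisson_mean_indicator
        bnd exp_bounded_add exp_bounded_cmult exp_bounded_const)
  also have "\<dots> = 7 / 500 + exp (- \<mu>) * (\<mu> / 6 + \<mu>\<^sup>2 / 54 + \<mu> ^ 3 / 300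
      - 7 / 500 * (\<mu> + \<mu>\<^sup>2 / 2 + \<mu> ^ 3 / 6) - 7 / 500)"
    by (simp add: fact_numeral algebra_simps)
  also have "\<dots> < 7 / 500 + exp (- \<mu>) * (3 / 500 * exp \<mu> + \<mu> / (\<mu> + 1))"
  proof (intro add_strict_left_mono mult_strict_left_mono)
    \<comment> \<open>Of the budget 1/50, the part 7/500 is spent on n \<ge> 4; the remaining 3/500
      appears here multiplied by exp \<mu>.\<close>
    show "\<mu> / 6 + \<mu>\<^sup>2 / 54 + \<mu> ^ 3 / 300 - 7 / 500 * (\<mu> + \<mu>\<^sup>2 / 2 + \<mu> ^ 3 / 6) - 7 / 500
        < 3 / 500 * exp \<mu> + \<mu> / (\<mu> + 1)"
      using polynomial_bound[OF assms] exp_ge_Taylor5[OF less_imp_le[OF assms]] by argo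
  qed simp
  also have "\<dots> = 1 / 50 + \<mu> * (exp (- \<mu>) / (\<mu> + 1))"
    by (simp add: distrib_left exp_minus field_simps)
  finally have 1: "\<mu> * poisson_mean ?i \<mu> < 1 / 50 + \<mu> * (exp (- \<mu>) / (\<mu> + 1))" .
  have "poisson_mean ln_half_corr \<mu> = poisson_mean (\<lambda>n. ln (real n + 1 / 2)) \<mu> + poisson_mean ?i \<mu>"
    unfolding ln_half_corr_def
    by (intro poisson_mean_add exp_bounded_ln_half exp_bounded_inverse_square)
  then have "exp (- \<mu>) / (\<mu> + 1) - poisson_mean ?i \<mu> \<le> poisson_mean (\<lambda>n. ln (real n + 1 / 2)) \<mu> - ln \<mu>"
    using poisson_mean_ln_half_corr_ge[OF assms] by simp
  then have "\<mu> * (exp (- \<mu>) / (\<mu> + 1) - poisson_mean ?i \<mu>)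
      \<le> \<mu> * (poisson_mean (\<lambda>n. ln (real n + 1 / 2)) \<mu> - ln \<mu>)"
    using assms by (intro mult_left_mono) auto
  then show ?thesis using 1 by (simp add: right_diff_distrib)
qed

text \<open>The difference of the two sides has derivative x^3 / (1 + x), which has the sign of x,
  so 0 is a global minimum. The odd degree matters: at degree 2 the derivative is - x^2 / (1 + x)
  and the difference changes sign.\<close>

lemma ln_le_cubic:
  fixes t :: real
  assumes "-1 < t"
  shows "ln (1 + t) \<le> t - t\<^sup>2 / 2 + t ^ 3 / 3"
proof -
  let ?f = "\<lambda>t. t - t\<^sup>2 / 2 + t ^ 3 / 3 - ln (1 + t) :: real"
  have deriv: "(?f has_real_derivative x ^ 3 / (1 + x)) (at x)" if "-1 < x" for x
  proof -
    have "(?f has_real_derivative 1 - x + x\<^sup>2 - 1 / (1 + x)) (at x)"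
      using that by (auto intro!: derivative_eq_intros simp: power2_eq_square)
    moreover have "1 - x + x\<^sup>2 - 1 / (1 + x) = x ^ 3 / (1 + x)"
      using that by (simp add: divide_simps) (simp add: power2_eq_square power3_eq_cube algebra_simps)
    ultimately show ?thesis by simp
  qed
  have "?f 0 \<le> ?f t"
  proof (cases "0 \<le> t")
    case True
    show ?thesis
    proof (rule DERIV_nonneg_imp_nondecreasing[OF True])
      fix x assume "0 \<le> x" "x \<le> t"
      then have "0 \<le> x ^ 3 / (1 + x)" by simp
      then show "\<exists>y. (?f has_real_derivative y) (at x) \<and> 0 \<le> y"
        using deriv[of x] \<open>0 \<le> x\<close> by auto
    qed
  next
    case False
    show ?thesis
    proof (rule DERIV_nonpos_imp_nonincreasing[of t 0 ?f])
      fix x assume x: "t \<le> x" "x \<le> 0"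
      have "x ^ 3 \<le> 0" using x by (simp add: power_le_zero_eq)
      then have "x ^ 3 / (1 + x) \<le> 0" using x assms by (intro divide_nonpos_pos) auto
      then show "\<exists>y. (?f has_real_derivative y) (at x) \<and> y \<le> 0"
        using deriv[of x] x assms by auto
    qed (use False in auto)
  qed
  then show ?thesis by simp
qed

text \<open>For \<mu> \<le> 1 the tangent of ln at \<mu> gives 1 / (2 \<mu>), which is enough there.
  For \<mu> > 1 that rate is too weak, and the cubic Taylor bound about \<mu> gives order \<mu> powr
  (-2).\<close>

lemma poisson_mean_ln_half_le:
  assumes "0 < \<mu>"
  shows "poisson_mean (\<lambda>n. ln (real n + 1 / 2)) \<mu> - ln \<mu> \<le> \<mu> powr (- 5 / 4)"
proof (cases "\<mu> \<le> 1")
  case True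
  have "poisson_mean (\<lambda>n. ln (real n + 1 / 2)) \<mu> \<le> poisson_mean (\<lambda>n. (ln \<mu> - 1 + 1 / (2 * \<mu>)) + 1 / \<mu> * real n) \<mu>"
  proof (rule poisson_mean_mono)
    fix n
    have "ln ((real n + 1 / 2) / \<mu>) \<le> (real n + 1 / 2) / \<mu> - 1"
      using assms by (intro ln_le_minus_one divide_pos_pos) auto
    moreover have "ln ((real n + 1 / 2) / \<mu>) = ln (real n + 1 / 2) - ln \<mu>"
      using assms by (subst ln_div) auto
    moreover have "(real n + 1 / 2) / \<mu> = 1 / (2 * \<mu>) + 1 / \<mu> * real n"
      using assms by (simp add: field_simps)
    ultimately show "ln (real n + 1 / 2) \<le> (ln \<mu> - 1 + 1 / (2 * \<mu>)) + 1 / \<mu> * real n"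
      by linarith
  next
    show "exp_bounded (\<lambda>n. (ln \<mu> - 1 + 1 / (2 * \<mu>)) + 1 / \<mu> * real n)"
      by (intro exp_bounded_add exp_bounded_cmult exp_bounded_const exp_bounded_of_nat)
  qed (use assms exp_bounded_ln_half in auto)
  also have "\<dots> = ln \<mu> + 1 / (2 * \<mu>)"
    using assms by (subst poisson_mean_add) (auto simp: exp_bounded_of_nat poisson_mean_const
        poisson_mean_cmult[of "\<lambda>n. real n" "1 / \<mu>", simplified] poisson_mean_of_nat
        exp_bounded_cmult[of "\<lambda>n. real n" "1 / \<mu>", simplified])
  finally have "poisson_mean (\<lambda>n. ln (real n + 1 / 2)) \<mu> - ln \<mu> \<le> 1 / (2 * \<mu>)" by simp
  also have "\<dots> \<le> \<mu> powr - 1" using assms by (simp add: powr_minus_divide frac_le)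
  also have "\<dots> \<le> \<mu> powr (- 5 / 4)" using assms True by (intro powr_mono') auto
  finally show ?thesis .
next
  case False
  then have \<mu>: "1 < \<mu>" by simp
  \<comment> \<open>The numbers c0, ..., c3 are the coefficients, in powers of n, of the cubic
    Taylor polynomial of ln (n + 1/2) about \<mu>.\<close>
  define c1 where "c1 = 3 / \<mu> - 3 / (2 * \<mu>\<^sup>2) + 1 / (4 * \<mu> ^ 3)"
  define c2 where "c2 = - 3 / (2 * \<mu>\<^sup>2) + 1 / (2 * \<mu> ^ 3)"
  define c3 where "c3 = 1 / (3 * \<mu> ^ 3)"
  define c0 where "c0 = ln \<mu> - 11 / 6 + 3 / (2 * \<mu>) - 3 / (8 * \<mu>\<^sup>2) + 1 / (24 * \<mu> ^ 3)"
  have "poisson_mean (\<lambda>n. ln (real n + 1 / 2)) \<mu>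
    \<le> poisson_mean (\<lambda>n. c0 + (c1 * real n + (c2 * real n ^ 2 + c3 * real n ^ 3))) \<mu>"
  proof (rule poisson_mean_mono)
    fix n
    define t where "t = (real n + 1 / 2) / \<mu> - 1"
    have "0 < (real n + 1 / 2) / \<mu>" using \<mu> by (intro divide_pos_pos) auto
    then have "ln (1 + t) \<le> t - t\<^sup>2 / 2 + t ^ 3 / 3"
      by (intro ln_le_cubic) (auto simp: t_def)
    moreover have "ln (1 + t) = ln (real n + 1 / 2) - ln \<mu>"
      using \<mu> by (simp add: t_def ln_div)
    moreover have "t - t\<^sup>2 / 2 + t ^ 3 / 3 + ln \<mu> = c0 + (c1 * real n + (c2 * real n ^ 2 + c3 * real n ^ 3))"
    proof -
      define v where "v = 1 / \<mu>"
      have t: "t = (real n + 1 / 2) * v - 1" by (simp add: t_def v_def)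
      have c: "c0 = ln \<mu> - 11 / 6 + 3 / 2 * v - 3 / 8 * v\<^sup>2 + 1 / 24 * v ^ 3"
        "c1 = 3 * v - 3 / 2 * v\<^sup>2 + 1 / 4 * v ^ 3" "c2 = - 3 / 2 * v\<^sup>2 + 1 / 2 * v ^ 3" "c3 = 1 / 3 * v ^ 3"
        by (simp_all add: c0_def c1_def c2_def c3_def v_def power_divide)
      show ?thesis unfolding t c by (simp add: power2_eq_square power3_eq_cube field_simps)
    qed
    ultimately show "ln (real n + 1 / 2) \<le> c0 + (c1 * real n + (c2 * real n ^ 2 + c3 * real n ^ 3))"
      by linarith
  qed (use \<mu> in \<open>auto intro!: exp_bounded_ln_half exp_bounded_add exp_bounded_cmult exp_bounded_of_nat
      exp_bounded_of_nat_power2 exp_bounded_of_nat_power3\<close>)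
  also have "\<dots> = c0 + (c1 * \<mu> + (c2 * (\<mu>\<^sup>2 + \<mu>) + c3 * (\<mu> ^ 3 + 3 * \<mu>\<^sup>2 + \<mu>)))"
    by (simp only: poisson_mean_add poisson_mean_cmult poisson_mean_const poisson_mean_of_nat
        poisson_mean_of_nat_power2 poisson_mean_of_nat_power3 exp_bounded_add exp_bounded_cmult
        exp_bounded_const exp_bounded_of_nat exp_bounded_of_nat_power2 exp_bounded_of_nat_power3)
  \<comment> \<open>The constants and the terms of order 1 / \<mu> cancel; the latter cancellation
    is special to the shift 1/2.\<close>
  also have "\<dots> = ln \<mu> + (17 / 24 / \<mu>\<^sup>2 + 1 / 24 / \<mu> ^ 3)"
    unfolding c0_def c1_def c2_def c3_def using \<mu>
    by (simp add: field_simps) (simp add: eval_nat_numeral algebra_simps)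
  finally have "poisson_mean (\<lambda>n. ln (real n + 1 / 2)) \<mu> - ln \<mu> \<le> 17 / 24 / \<mu>\<^sup>2 + 1 / 24 / \<mu> ^ 3" by simp
  also have "1 / 24 / \<mu> ^ 3 \<le> 1 / 24 / \<mu> ^ 2"
    using \<mu> by (intro divide_left_mono power_increasing) auto
  also have "17 / 24 / \<mu>\<^sup>2 + 1 / 24 / \<mu>\<^sup>2 \<le> 1 / \<mu> ^ 2" using \<mu> by (simp add: field_simps)
  also have "\<dots> = \<mu> powr - 2" using \<mu> by (simp add: powr_minus_divide powr_numeral)
  also have "\<dots> \<le> \<mu> powr (- 5 / 4)" using \<mu> by (intro powr_mono) auto
  finally show ?thesis by simp
qed

section \<open>The Poisson mean of the log-Gamma function\<close>

definition ln_Gamma_half :: "nat \<Rightarrow> real" where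
  "ln_Gamma_half n = ln (Gamma (real n + 1 / 2))"

lemma ln_Gamma_half_Suc: "ln_Gamma_half (Suc n) = ln_Gamma_half n + ln (real n + 1 / 2)"
proof -
  have "Gamma (real (Suc n) + 1 / 2) = (real n + 1 / 2) * Gamma (real n + 1 / 2)"
    using Gamma_plus1[of "real n + 1 / 2"] nonpos_Ints_nonpos[of "real n + 1 / 2"]
    by (metis add.assoc add.commute of_nat_Suc add_pos_nonneg half_gt_zero_iff linorder_not_le of_nat_0_le_iff zero_less_one add_nonneg_pos)
  moreover have "Gamma (real n + 1 / 2) \<noteq> 0" using Gamma_real_pos[of "real n + 1 / 2"] by force
  ultimately show ?thesis
    unfolding ln_Gamma_half_def by (simp add: ln_mult)
qed

lemma exp_bounded_ln_Gamma_half: "exp_bounded ln_Gamma_half"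
proof -
  obtain C where C: "\<And>n. \<bar>ln (real n + 1 / 2)\<bar> \<le> C * 2 ^ n"
    using exp_bounded_ln_half by (auto simp: exp_bounded_def)
  define D where "D = \<bar>C\<bar> + \<bar>ln_Gamma_half 0\<bar>"
  have "\<bar>ln_Gamma_half n\<bar> \<le> D * 2 ^ n" for n
  proof (induction n)
    case (Suc n)
    have "C * 2 ^ n \<le> D * 2 ^ n" by (intro mult_right_mono) (auto simp: D_def)
    then show ?case using Suc C[of n] unfolding ln_Gamma_half_Suc power_Suc by linarith
  qed (simp add: D_def)
  then show ?thesis by (rule exp_boundedI)
qed

text \<open>The subtracted \<mu> * ln \<mu> - \<mu> is a primitive of ln, so the derivative is the
  difference that the preceding lemmas bound from both sides.\<close>

definition gamma_gap :: "real \<Rightarrow> real" where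
  "gamma_gap \<mu> = poisson_mean ln_Gamma_half \<mu> - \<mu> * ln \<mu> + \<mu>"

lemma gamma_gap_deriv:
  assumes "0 < \<mu>"
  shows "(gamma_gap has_real_derivative poisson_mean (\<lambda>n. ln (real n + 1 / 2)) \<mu> - ln \<mu>) (at \<mu>)"
proof -
  have "(poisson_mean ln_Gamma_half has_real_derivative poisson_mean (\<lambda>n. ln (real n + 1 / 2)) \<mu>) (at \<mu>)"
    using poisson_mean_deriv[OF exp_bounded_ln_Gamma_half, of \<mu>] by (simp add: ln_Gamma_half_Suc)
  then show ?thesis
    unfolding gamma_gap_def[abs_def] using assms by (auto intro!: derivative_eq_intros)
qed

lemma gamma_gap_diff_less:
  assumes "0 < a" "a < b"
  shows "gamma_gap a - gamma_gap b < 1 / 50 * ln (b / a)"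
proof -
  have "gamma_gap a + 1 / 50 * ln a < gamma_gap b + 1 / 50 * ln b"
  proof (rule DERIV_pos_imp_increasing[OF assms(2)])
    fix x assume "a \<le> x" "x \<le> b"
    then have x: "0 < x" using assms by simp
    have "((\<lambda>x. gamma_gap x + 1 / 50 * ln x) has_real_derivative
        poisson_mean (\<lambda>n. ln (real n + 1 / 2)) x - ln x + 1 / 50 * (1 / x)) (at x)"
      using x by (auto intro!: derivative_eq_intros gamma_gap_deriv)
    moreover have "0 < poisson_mean (\<lambda>n. ln (real n + 1 / 2)) x - ln x + 1 / 50 * (1 / x)"
      using poisson_mean_ln_half_gt[OF x] x by (simp add: field_simps)
    ultimately show "\<exists>y. ((\<lambda>x. gamma_gap x + 1 / 50 * ln x) has_real_derivative y) (at x) \<and> 0 < y"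
      by blast
  qed
  then show ?thesis using assms by (simp add: ln_div)
qed

text \<open>The factor 4 and the exponent -1/4 arise by integrating x powr (- 5 / 4) from a to b;
  the contribution of b has a favourable sign and is dropped.\<close>

lemma gamma_gap_diff_ge:
  assumes "0 < a" "a \<le> b"
  shows "- 4 * a powr (- 1 / 4) \<le> gamma_gap a - gamma_gap b"
proof -
  have "gamma_gap b + 4 * b powr (- 1 / 4) \<le> gamma_gap a + 4 * a powr (- 1 / 4)"
  proof (rule DERIV_nonpos_imp_nonincreasing[OF assms(2)])
    fix x assume "a \<le> x" "x \<le> b"
    then have x: "0 < x" using assms by simp
    have "((\<lambda>x. gamma_gap x + 4 * x powr (- 1 / 4)) has_real_derivative
        poisson_mean (\<lambda>n. ln (real n + 1 / 2)) x - ln x + - (x powr (- 5 / 4))) (at x)"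
      using x by (auto intro!: derivative_eq_intros gamma_gap_deriv)
    moreover have "poisson_mean (\<lambda>n. ln (real n + 1 / 2)) x - ln x + - (x powr (- 5 / 4)) \<le> 0"
      using poisson_mean_ln_half_le[OF x] by simp
    ultimately show "\<exists>y. ((\<lambda>x. gamma_gap x + 4 * x powr (- 1 / 4)) has_real_derivative y) (at x) \<and> y \<le> 0"
      by blast
  qed
  moreover have "0 \<le> b powr (- 1 / 4)" by simp
  ultimately show ?thesis by linarith
qed

section \<open>The risk of Bayesian predictive distributions for gamma priors\<close>

lemma integrable_measure_pmf_iff:
  fixes f :: "'a \<Rightarrow> real"
  shows "integrable (measure_pmf p) f \<longleftrightarrow> integrable (count_space UNIV) (\<lambda>x. pmf p x * f x)"
  unfolding measure_pmf_eq_density by (subst integrable_density) auto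

lemma expectation_pmf_eq_count_space:
  fixes f :: "'a \<Rightarrow> real"
  shows "measure_pmf.expectation p f = (\<integral>x. pmf p x * f x \<partial>count_space UNIV)"
  unfolding measure_pmf_eq_density by (subst integral_density) auto

lemma poisson_pmf_expectation:
  assumes "0 < \<mu>" "exp_bounded \<phi>"
  shows "integrable (poisson_pmf \<mu>) \<phi>" "measure_pmf.expectation (poisson_pmf \<mu>) \<phi> = poisson_mean \<phi> \<mu>"
proof -
  let ?f = "\<lambda>n. exp (- \<mu>) * (\<phi> n / fact n * \<mu> ^ n)"
  have eq: "pmf (poisson_pmf \<mu>) n * \<phi> n = ?f n" for n
    using assms(1) by simp
  have int: "integrable (count_space UNIV) ?f"
    unfolding integrable_count_space_nat_iff
    using summable_mult[OF poisson_mean_summable_abs[OF assms(2), of \<mu>], of "exp (- \<mu>)"]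
    by (simp add: abs_mult)
  then show "integrable (poisson_pmf \<mu>) \<phi>"
    unfolding integrable_measure_pmf_iff eq .
  show "measure_pmf.expectation (poisson_pmf \<mu>) \<phi> = poisson_mean \<phi> \<mu>"
    unfolding expectation_pmf_eq_count_space eq integral_count_space_nat[OF int] poisson_mean_def
    by (rule suminf_mult[OF poisson_mean_summable[OF assms(2)]])
qed

text \<open>Superposition of independent Poisson variables: the mass at n only involves x \<le> n,
  so the series is a finite sum to which the binomial theorem applies. It makes x + y a single
  Poisson variable in the risk.\<close>

lemma bind_poisson_pmf:
  assumes "0 < a" "0 < b"
  shows "bind_pmf (poisson_pmf a) (\<lambda>x. map_pmf (\<lambda>y. x + y) (poisson_pmf b)) = poisson_pmf (a + b)"
proof (rule pmf_eqI)
  fix n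
  let ?c = "\<lambda>x. if x \<le> n then pmf (poisson_pmf b) (n - x) else 0"
  have eq: "pmf (map_pmf (\<lambda>y. x + y) (poisson_pmf b)) n = ?c x" for x
  proof (cases "x \<le> n")
    case True
    then show ?thesis
      using pmf_map_inj'[of "\<lambda>y. x + y" "poisson_pmf b" "n - x"] by simp
  next
    case False
    then show ?thesis by (subst pmf_map_outside) auto
  qed
  have "\<bar>?c x\<bar> \<le> 1" for x by (simp add: pmf_le_1 del: pmf_poisson)
  then have b: "exp_bounded ?c" by (rule exp_bounded_bounded)
  have "pmf (bind_pmf (poisson_pmf a) (\<lambda>x. map_pmf (\<lambda>y. x + y) (poisson_pmf b))) n = poisson_mean ?c a"
    unfolding pmf_bind eq by (rule poisson_pmf_expectation(2)[OF assms(1) b])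
  also have "\<dots> = exp (- a) * (\<Sum>x\<le>n. ?c x / fact x * a ^ x)"
    unfolding poisson_mean_def by (subst suminf_finite[of "{..n}"]) auto
  also have "\<dots> = exp (- a) * (\<Sum>x\<le>n. exp (- b) / fact n * (of_nat (n choose x) * a ^ x * b ^ (n - x)))"
  proof -
    have "?c x / fact x * a ^ x = exp (- b) / fact n * (of_nat (n choose x) * a ^ x * b ^ (n - x))"
      if "x \<le> n" for x
      using that assms by (simp add: binomial_fact field_simps)
    then show ?thesis by simp
  qed
  also have "\<dots> = exp (- a) * exp (- b) / fact n * (a + b) ^ n"
    unfolding binomial_ring sum_distrib_left[symmetric] by simp
  also have "\<dots> = pmf (poisson_pmf (a + b)) n"
    using assms by (simp add: exp_add[symmetric])
  finally show "pmf (bind_pmf (poisson_pmf a) (\<lambda>x. map_pmf (\<lambda>y. x + y) (poisson_pmf b))) n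
      = pmf (poisson_pmf (a + b)) n" .
qed

lemma exp_bounded_power2: "exp_bounded (\<lambda>n. 2 ^ n)"
  by (rule exp_boundedI[where C = 1]) simp

lemma exp_bounded_poisson_mean_shift:
  assumes "0 < b" "exp_bounded \<phi>"
  shows "exp_bounded (\<lambda>x. poisson_mean (\<lambda>y. \<phi> (x + y)) b)"
proof -
  obtain C where C: "\<And>n. \<bar>\<phi> n\<bar> \<le> C * 2 ^ n"
    using assms by (auto simp: exp_bounded_def)
  have "\<bar>poisson_mean (\<lambda>y. \<phi> (x + y)) b\<bar> \<le> (C * poisson_mean (\<lambda>n. 2 ^ n) b) * 2 ^ x" for x
  proof -
    have le: "\<bar>\<phi> (x + y)\<bar> \<le> (C * 2 ^ x) * 2 ^ y" for y
      using C[of "x + y"] by (simp add: power_add mult_ac)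
    have "poisson_mean (\<lambda>y. \<phi> (x + y)) b \<le> poisson_mean (\<lambda>y. (C * 2 ^ x) * 2 ^ y) b"
      using assms le by (intro poisson_mean_mono exp_bounded_shift exp_bounded_cmult exp_bounded_power2)
        (auto simp: abs_le_iff)
    moreover have "poisson_mean (\<lambda>y. (- (C * 2 ^ x)) * 2 ^ y) b \<le> poisson_mean (\<lambda>y. \<phi> (x + y)) b"
    proof (intro poisson_mean_mono exp_bounded_shift exp_bounded_cmult exp_bounded_power2)
      show "- (C * 2 ^ x) * 2 ^ y \<le> \<phi> (x + y)" for y
        using le[of y] by (simp only: abs_le_iff mult_minus_left) linarith
    qed (use assms in auto)
    ultimately have "\<bar>poisson_mean (\<lambda>y. \<phi> (x + y)) b\<bar> \<le> (C * 2 ^ x) * poisson_mean (\<lambda>n. 2 ^ n) b"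
      unfolding poisson_mean_cmult[OF exp_bounded_power2] by (simp add: abs_le_iff)
    then show ?thesis by (simp add: mult_ac)
  qed
  then show ?thesis by (rule exp_boundedI)
qed

lemma nn_integral_poisson_pmf:
  assumes "0 < \<mu>" "exp_bounded \<phi>" "\<And>n. 0 \<le> \<phi> n"
  shows "(\<integral>\<^sup>+n. ennreal (\<phi> n) \<partial>poisson_pmf \<mu>) = ennreal (poisson_mean \<phi> \<mu>)"
  using assms by (subst nn_integral_eq_integral) (auto simp: poisson_pmf_expectation)

lemma poisson_mean_nonneg:
  "0 \<le> \<mu> \<Longrightarrow> exp_bounded \<phi> \<Longrightarrow> (\<And>n. 0 \<le> \<phi> n) \<Longrightarrow> 0 \<le> poisson_mean \<phi> \<mu>"
  using poisson_mean_mono[of "\<lambda>_. 0" \<phi> \<mu>] by (auto simp: poisson_mean_const)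

lemma poisson_mean_convolution_nonneg:
  assumes "0 < a" "0 < b" "exp_bounded \<phi>" "\<And>n. 0 \<le> \<phi> n"
  shows "poisson_mean (\<lambda>x. poisson_mean (\<lambda>y. \<phi> (x + y)) b) a = poisson_mean \<phi> (a + b)"
proof -
  have "ennreal (poisson_mean \<phi> (a + b)) = (\<integral>\<^sup>+n. ennreal (\<phi> n) \<partial>poisson_pmf (a + b))"
    using assms by (subst nn_integral_poisson_pmf) auto
  also have "\<dots> = (\<integral>\<^sup>+x. \<integral>\<^sup>+y. ennreal (\<phi> (x + y)) \<partial>poisson_pmf b \<partial>poisson_pmf a)"
    unfolding bind_poisson_pmf[OF assms(1,2), symmetric] by simp
  also have "\<dots> = (\<integral>\<^sup>+x. ennreal (poisson_mean (\<lambda>y. \<phi> (x + y)) b) \<partial>poisson_pmf a)"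
    using assms by (subst nn_integral_poisson_pmf) auto
  also have "\<dots> = ennreal (poisson_mean (\<lambda>x. poisson_mean (\<lambda>y. \<phi> (x + y)) b) a)"
    using assms
    by (intro nn_integral_poisson_pmf exp_bounded_poisson_mean_shift poisson_mean_nonneg exp_bounded_shift) auto
  finally show ?thesis
    using assms by (subst (asm) ennreal_inj)
      (auto intro!: poisson_mean_nonneg exp_bounded_poisson_mean_shift exp_bounded_shift)
qed

text \<open>Adding the majorant C * 2 ^ n makes a signed function nonnegative. The nonnegative case,
  which rests on extended nonnegative integrals alone, applies to the sum and to the majorant, and
  the two results are subtracted.\<close>

lemma poisson_mean_convolution:
  assumes "0 < a" "0 < b" "exp_bounded \<phi>"
  shows "poisson_mean (\<lambda>x. poisson_mean (\<lambda>y. \<phi> (x + y)) b) a = poisson_mean \<phi> (a + b)"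
proof -
  obtain C where C: "\<And>n. \<bar>\<phi> n\<bar> \<le> C * 2 ^ n"
    using assms by (auto simp: exp_bounded_def)
  define \<psi> where "\<psi> n = C * 2 ^ n" for n :: nat
  have b: "exp_bounded \<psi>" unfolding \<psi>_def by (intro exp_bounded_cmult exp_bounded_power2)
  have nn: "0 \<le> \<psi> n" "0 \<le> \<phi> n + \<psi> n" for n using C[of n] unfolding \<psi>_def by linarith+
  note bs = b assms(3) exp_bounded_add[OF assms(3) b] exp_bounded_shift exp_bounded_poisson_mean_shift[OF assms(2)]
  have "poisson_mean (\<lambda>x. poisson_mean (\<lambda>y. \<phi> (x + y) + \<psi> (x + y)) b) a
      = poisson_mean (\<lambda>n. \<phi> n + \<psi> n) (a + b)"
    using poisson_mean_convolution_nonneg[OF assms(1,2) bs(3) nn(2)] .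
  moreover have "poisson_mean (\<lambda>x. poisson_mean (\<lambda>y. \<psi> (x + y)) b) a = poisson_mean \<psi> (a + b)"
    using poisson_mean_convolution_nonneg[OF assms(1,2) b nn(1)] .
  ultimately show ?thesis by (simp add: poisson_mean_add bs)
qed

section \<open>The product Poisson law and extended sums\<close>

definition poisson_vec_pmf :: "real ^ 'n \<Rightarrow> real ^ 'n \<Rightarrow> (nat ^ 'n) pmf" where
  "poisson_vec_pmf r l = map_pmf vec_lambda (Pi_pmf UNIV 0 (\<lambda>i. poisson_pmf (r $ i * l $ i)))"

lemma pmf_poisson_vec_pmf:
  assumes "\<And>i. 0 < r $ i" "\<And>i. 0 < l $ i"
  shows "pmf (poisson_vec_pmf r l) x = poisson_vec r l x"
proof -
  have "inj (vec_lambda :: ('n \<Rightarrow> nat) \<Rightarrow> nat ^ 'n)" by (rule injI) (metis vec_lambda_inverse UNIV_I)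
  then have "pmf (poisson_vec_pmf r l) (vec_lambda (vec_nth x))
      = pmf (Pi_pmf UNIV 0 (\<lambda>i. poisson_pmf (r $ i * l $ i))) (vec_nth x)"
    unfolding poisson_vec_pmf_def by (rule pmf_map_inj')
  then show ?thesis
    using assms by (simp add: pmf_Pi poisson_vec_def)
qed

lemma map_poisson_vec_pmf: "map_pmf (\<lambda>x. x $ i) (poisson_vec_pmf r l) = poisson_pmf (r $ i * l $ i)"
  unfolding poisson_vec_pmf_def by (simp add: pmf.map_comp o_def Pi_pmf_component)

lemma poisson_vec_expectation:
  assumes "\<And>i. 0 < r $ i" "\<And>i. 0 < l $ i" "exp_bounded \<phi>"
  shows "integrable (poisson_vec_pmf r l) (\<lambda>x. \<phi> (x $ i))"
    "measure_pmf.expectation (poisson_vec_pmf r l) (\<lambda>x. \<phi> (x $ i)) = poisson_mean \<phi> (r $ i * l $ i)"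
  using poisson_pmf_expectation[OF mult_pos_pos[OF assms(1)[of i] assms(2)[of i]] assms(3)]
  unfolding map_poisson_vec_pmf[symmetric] by simp_all

lemma ext_sum_ereal:
  assumes "integrable (count_space UNIV) f"
  shows "ext_sum (\<lambda>x. ereal (f x)) = ereal (\<integral>x. f x \<partial>count_space UNIV)"
proof -
  have e: "e2ennreal (ereal (f x)) = ennreal (f x)" "e2ennreal (- ereal (f x)) = ennreal (- f x)" for x
    by (simp_all add: e2ennreal_ereal)
  have "(\<integral>\<^sup>+ x. ennreal (f x) \<partial>count_space UNIV) \<noteq> \<infinity>" "(\<integral>\<^sup>+ x. ennreal (- f x) \<partial>count_space UNIV) \<noteq> \<infinity>"
    using assms by (auto simp: real_integrable_def)
  moreover have "enn2ereal X = ereal (enn2real X)" if "X \<noteq> \<infinity>" for X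
    using that by (cases X) (auto simp: ennreal.rep_eq)
  ultimately show ?thesis
    unfolding ext_sum_def e real_lebesgue_integral_def[OF assms] by simp
qed

lemma ext_sum_mono:
  assumes "\<And>x. f x \<le> g x"
  shows "ext_sum f \<le> ext_sum g"
  unfolding ext_sum_def using assms
  by (intro ereal_minus_mono) (auto simp: less_eq_ennreal.rep_eq[symmetric] intro!: nn_integral_mono e2ennreal_mono)

lemma ext_sum_pmf:
  assumes "integrable (measure_pmf p) f"
  shows "ext_sum (\<lambda>x. ereal (pmf p x * f x)) = ereal (measure_pmf.expectation p f)"
  unfolding expectation_pmf_eq_count_space
  using assms by (intro ext_sum_ereal) (simp add: integrable_measure_pmf_iff)


text \<open>The integral of l powr (k - 1/2) * exp (- c * l) over l > 0, that is, the normalising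
  constant of the gamma density of shape k + 1/2 and rate c.\<close>

definition gamma_mass :: "real \<Rightarrow> nat \<Rightarrow> real" where
  "gamma_mass c k = Gamma (real k + 1 / 2) / c powr (real k + 1 / 2)"

lemma gamma_mass_pos: "0 < c \<Longrightarrow> 0 < gamma_mass c k"
  unfolding gamma_mass_def by (intro divide_pos_pos Gamma_real_pos) auto

lemma ln_gamma_mass:
  assumes "0 < c"
  shows "ln (gamma_mass c k) = ln_Gamma_half k - (real k + 1 / 2) * ln c"
proof -
  have "0 < Gamma (real k + 1 / 2)" by (rule Gamma_real_pos) simp
  then show ?thesis
    unfolding gamma_mass_def ln_Gamma_half_def using assms by (subst ln_divide_pos) (auto simp: ln_powr)
qed

text \<open>The Bayesian predictive distribution for the prior density proportional to
  \<open>\<Prod>i. l $ i powr (- 1 / 2) * exp (- \<beta> * l $ i)\<close>; the Jeffreys prior is the case \<open>\<beta> = 0\<close>.\<close>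

definition gamma_predictive ::
  "real \<Rightarrow> real ^ 'n \<Rightarrow> real ^ 'n \<Rightarrow> nat ^ 'n \<Rightarrow> nat ^ 'n \<Rightarrow> real" where
  "gamma_predictive \<beta> r s x y =
    (\<Prod>i\<in>UNIV. (s $ i) ^ (y $ i) / fact (y $ i) * gamma_mass (r $ i + s $ i + \<beta>) (x $ i + y $ i)
      / gamma_mass (r $ i + \<beta>) (x $ i))"

text \<open>The logarithm of one coordinate's factor of sampling density over predictive density,
  after the factorials and the powers of s have cancelled. It is arranged as an affine function of b
  minus \<open>ln_Gamma_half (a + b)\<close>, so that the Poisson mean in b can be read off term by
  term.\<close>

definition log_ratio :: "real \<Rightarrow> real \<Rightarrow> real \<Rightarrow> real \<Rightarrow> nat \<Rightarrow> nat \<Rightarrow> real" where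
  "log_ratio \<beta> r s l a b = (ln l + ln (r + s + \<beta>)) * real b
    + ((real a + 1 / 2) * (ln (r + s + \<beta>) - ln (r + \<beta>)) + ln_Gamma_half a - s * l - ln_Gamma_half (a + b))"

text \<open>The last summand is the price of \<beta>: it vanishes at \<beta> = 0 and, by
  \<open>mult_ln_add_div_mono\<close>, is nonnegative otherwise.\<close>

definition coordinate_risk :: "real \<Rightarrow> real \<Rightarrow> real \<Rightarrow> real \<Rightarrow> real" where
  "coordinate_risk \<beta> r s l = gamma_gap (r * l) - gamma_gap ((r + s) * l)
    + 1 / 2 * ln ((r + s + \<beta>) / (r + \<beta>))
    + l * ((r + s) * ln ((r + s + \<beta>) / (r + s)) - r * ln ((r + \<beta>) / r))"

lemma ln_poisson_div_predictive:
  assumes "0 < r" "0 < s" "0 < l" "0 \<le> \<beta>"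
  shows "ln ((s * l) ^ b * exp (- (s * l)) / fact b
      / (s ^ b / fact b * gamma_mass (r + s + \<beta>) (a + b) / gamma_mass (r + \<beta>) a)) = log_ratio \<beta> r s l a b"
proof -
  have g: "0 < gamma_mass (r + s + \<beta>) (a + b)" "0 < gamma_mass (r + \<beta>) a"
    using assms by (auto intro!: gamma_mass_pos)
  have "(s * l) ^ b * exp (- (s * l)) / fact b
      / (s ^ b / fact b * gamma_mass (r + s + \<beta>) (a + b) / gamma_mass (r + \<beta>) a)
      = l ^ b * exp (- (s * l)) * gamma_mass (r + \<beta>) a / gamma_mass (r + s + \<beta>) (a + b)"
    using assms g by (simp add: power_mult_distrib)
  also have "ln \<dots> = real b * ln l - s * l + ln (gamma_mass (r + \<beta>) a) - ln (gamma_mass (r + s + \<beta>) (a + b))"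
    using assms g by (simp add: ln_divide_pos ln_mult_pos ln_realpow)
  also have "\<dots> = log_ratio \<beta> r s l a b"
    using assms by (simp add: ln_gamma_mass log_ratio_def algebra_simps)
  finally show ?thesis .
qed

lemma exp_bounded_log_ratio: "exp_bounded (log_ratio \<beta> r s l a)"
  unfolding log_ratio_def
  by (intro exp_bounded_add exp_bounded_diff exp_bounded_cmult exp_bounded_const exp_bounded_of_nat
      exp_bounded_shift exp_bounded_ln_Gamma_half)

lemma poisson_mean_log_ratio:
  "poisson_mean (log_ratio \<beta> r s l a) (s * l) = (ln (r + s + \<beta>) - ln (r + \<beta>)) * real a
    + (((ln l + ln (r + s + \<beta>)) * (s * l) + 1 / 2 * (ln (r + s + \<beta>) - ln (r + \<beta>)) - s * l)
    + (ln_Gamma_half a - poisson_mean (\<lambda>b. ln_Gamma_half (a + b)) (s * l)))"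
proof -
  have "poisson_mean (log_ratio \<beta> r s l a) (s * l) = (ln l + ln (r + s + \<beta>)) * (s * l)
    + ((real a + 1 / 2) * (ln (r + s + \<beta>) - ln (r + \<beta>)) + ln_Gamma_half a - s * l
       - poisson_mean (\<lambda>b. ln_Gamma_half (a + b)) (s * l))"
    unfolding log_ratio_def
    by (simp only: poisson_mean_add poisson_mean_diff poisson_mean_cmult poisson_mean_const
        poisson_mean_of_nat exp_bounded_add exp_bounded_diff exp_bounded_cmult exp_bounded_const
        exp_bounded_of_nat exp_bounded_shift exp_bounded_ln_Gamma_half)
  then show ?thesis by (simp add: algebra_simps)
qed

lemma exp_bounded_poisson_mean_log_ratio:
  assumes "0 < s" "0 < l"
  shows "exp_bounded (\<lambda>a. poisson_mean (log_ratio \<beta> r s l a) (s * l))"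
  unfolding poisson_mean_log_ratio using assms
  by (intro exp_bounded_add exp_bounded_diff exp_bounded_cmult exp_bounded_const exp_bounded_of_nat
      exp_bounded_poisson_mean_shift exp_bounded_ln_Gamma_half) auto

text \<open>The affine part only needs first moments. In \<open>ln_Gamma_half (a + b)\<close> the
  argument is a sum of independent Poisson variables, so averaging over both a and b gives one
  Poisson mean at (r + s) * l.\<close>

lemma poisson_mean_poisson_mean_log_ratio:
  assumes "0 < r" "0 < s" "0 < l" "0 \<le> \<beta>"
  shows "poisson_mean (\<lambda>a. poisson_mean (log_ratio \<beta> r s l a) (s * l)) (r * l) = coordinate_risk \<beta> r s l"
proof -
  have "0 < r * l" "0 < s * l" using assms by auto
  note conv = poisson_mean_convolution[OF this exp_bounded_ln_Gamma_half]
  have "poisson_mean (\<lambda>a. poisson_mean (log_ratio \<beta> r s l a) (s * l)) (r * l)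
    = (ln (r + s + \<beta>) - ln (r + \<beta>)) * (r * l)
    + (((ln l + ln (r + s + \<beta>)) * (s * l) + 1 / 2 * (ln (r + s + \<beta>) - ln (r + \<beta>)) - s * l)
    + (poisson_mean ln_Gamma_half (r * l) - poisson_mean ln_Gamma_half (r * l + s * l)))"
    unfolding poisson_mean_log_ratio conv[symmetric]
    by (simp only: poisson_mean_add poisson_mean_diff poisson_mean_cmult poisson_mean_const
        poisson_mean_of_nat exp_bounded_add exp_bounded_diff exp_bounded_cmult exp_bounded_const
        exp_bounded_of_nat exp_bounded_poisson_mean_shift exp_bounded_ln_Gamma_half \<open>0 < s * l\<close>)
  also have "\<dots> = coordinate_risk \<beta> r s l"
  proof -
    have "r * l + s * l = (r + s) * l" "ln (r * l) = ln r + ln l" "ln ((r + s) * l) = ln (r + s) + ln l"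
      "ln ((r + s + \<beta>) / (r + \<beta>)) = ln (r + s + \<beta>) - ln (r + \<beta>)"
      "ln ((r + s + \<beta>) / (r + s)) = ln (r + s + \<beta>) - ln (r + s)"
      "ln ((r + \<beta>) / r) = ln (r + \<beta>) - ln r"
      using assms ln_mult_pos[of "r + s" l] by (simp_all add: ln_divide_pos ln_mult_pos distrib_right)
    note eqs = this
    show ?thesis
      unfolding coordinate_risk_def gamma_gap_def eqs by (simp add: algebra_simps)
  qed
  finally show ?thesis .
qed

lemma gamma_predictive_pos:
  assumes "\<And>i. 0 < r $ i" "\<And>i. 0 < s $ i" "0 \<le> \<beta>"
  shows "0 < gamma_predictive \<beta> r s x y"
  unfolding gamma_predictive_def using assms
  by (intro prod_pos ballI divide_pos_pos mult_pos_pos gamma_mass_pos add_pos_nonneg add_pos_pos) auto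

lemma poisson_vec_pos:
  "(\<And>i. 0 < r $ i) \<Longrightarrow> (\<And>i. 0 < l $ i) \<Longrightarrow> 0 < poisson_vec r l x"
  unfolding poisson_vec_def by (intro prod_pos) simp

lemma ln_poisson_vec_div_gamma_predictive:
  fixes r s l :: "real ^ 'n"
  assumes "\<And>i. 0 < r $ i" "\<And>i. 0 < s $ i" "\<And>i. 0 < l $ i" "0 \<le> \<beta>"
  shows "ln (poisson_vec s l y / gamma_predictive \<beta> r s x y)
    = (\<Sum>i\<in>UNIV. log_ratio \<beta> (r $ i) (s $ i) (l $ i) (x $ i) (y $ i))"
proof -
  have "gamma_mass c k \<noteq> 0" if "0 < c" for c k using gamma_mass_pos[OF that, of k] by simp
  moreover have "r $ i + s $ i + \<beta> > 0" "r $ i + \<beta> > 0" for i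
    using assms(1)[of i] assms(2)[of i] assms(4) by linarith+
  moreover have "r $ i \<noteq> 0" "s $ i \<noteq> 0" "l $ i \<noteq> 0" for i using assms(1-3)[of i] by auto
  ultimately show ?thesis
    unfolding poisson_vec_def gamma_predictive_def prod_dividef[symmetric]
    by (subst ln_prod, simp, (auto)[1]) (intro sum.cong refl ln_poisson_div_predictive assms)
qed

text \<open>K is the log-likelihood ratio and H its conditional mean given x. These facts are
  separate from the risk formula because the bound for an arbitrary q compares with the same K and
  H.\<close>

lemma kl_risk_gamma_predictive_inner:
  fixes r s l :: "real ^ 'n"
  assumes "\<And>i. 0 < r $ i" "\<And>i. 0 < s $ i" "\<And>i. 0 < l $ i" "0 \<le> \<beta>"
  defines "K \<equiv> \<lambda>x y. \<Sum>i\<in>UNIV. log_ratio \<beta> (r $ i) (s $ i) (l $ i) (x $ i) (y $ i)"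
    and "H \<equiv> \<lambda>x. \<Sum>i\<in>UNIV. poisson_mean (log_ratio \<beta> (r $ i) (s $ i) (l $ i) (x $ i)) (s $ i * l $ i)"
  shows "integrable (poisson_vec_pmf s l) (K x)"
    and "measure_pmf.expectation (poisson_vec_pmf s l) (K x) = H x"
    and "integrable (poisson_vec_pmf r l) H"
    and "measure_pmf.expectation (poisson_vec_pmf r l) H = (\<Sum>i\<in>UNIV. coordinate_risk \<beta> (r $ i) (s $ i) (l $ i))"
proof -
  note E = poisson_vec_expectation[of s l, OF assms(2,3) exp_bounded_log_ratio]
  note E' = poisson_vec_expectation[of r l, OF assms(1,3) exp_bounded_poisson_mean_log_ratio[OF assms(2,3)]]
  show "integrable (poisson_vec_pmf s l) (K x)"
    "measure_pmf.expectation (poisson_vec_pmf s l) (K x) = H x"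
    unfolding K_def H_def using E by (simp_all add: Bochner_Integration.integral_sum)
  show "integrable (poisson_vec_pmf r l) H"
    "measure_pmf.expectation (poisson_vec_pmf r l) H = (\<Sum>i\<in>UNIV. coordinate_risk \<beta> (r $ i) (s $ i) (l $ i))"
    unfolding H_def using E'
    by (simp_all add: Bochner_Integration.integral_sum poisson_mean_poisson_mean_log_ratio assms)
qed

lemma kl_risk_gamma_predictive:
  fixes r s l :: "real ^ 'n"
  assumes "\<And>i. 0 < r $ i" "\<And>i. 0 < s $ i" "\<And>i. 0 < l $ i" "0 \<le> \<beta>"
  shows "kl_risk r s (gamma_predictive \<beta> r s) l
    = ereal (\<Sum>i\<in>UNIV. coordinate_risk \<beta> (r $ i) (s $ i) (l $ i))"
proof -
  note inner = kl_risk_gamma_predictive_inner[OF assms]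
  have "kl_term (poisson_vec s l y) (gamma_predictive \<beta> r s x y)
      = ereal (pmf (poisson_vec_pmf s l) y * (\<Sum>i\<in>UNIV. log_ratio \<beta> (r $ i) (s $ i) (l $ i) (x $ i) (y $ i)))"
    for x y
    using poisson_vec_pos[OF assms(2,3), of y] gamma_predictive_pos[OF assms(1,2,4), of x y]
    by (simp add: kl_term_def ln_poisson_vec_div_gamma_predictive pmf_poisson_vec_pmf assms)
  then show ?thesis
    unfolding kl_risk_def
    by (simp add: ext_sum_pmf inner pmf_poisson_vec_pmf[of r l, OF assms(1,3), symmetric])
qed

section \<open>Gamma integrals over the orthant\<close>

text \<open>The product formula for \<open>lborel\<close> is indexed by basis vectors; the injective
  map from indices to axis vectors reindexes it by coordinates.\<close>

lemma nn_integral_lborel_vec: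
  fixes f :: "'n::finite \<Rightarrow> real \<Rightarrow> ennreal"
  assumes [measurable]: "\<And>i. f i \<in> borel_measurable borel"
  shows "(\<integral>\<^sup>+l. (\<Prod>i\<in>UNIV. f i (l $ i)) \<partial>(lborel :: (real ^ 'n) measure))
    = (\<Prod>i\<in>UNIV. \<integral>\<^sup>+x. f i x \<partial>lborel)"
proof -
  let ?e = "\<lambda>i. axis i 1 :: real ^ 'n"
  have inj: "inj ?e" by (auto intro!: injI simp: axis_eq_axis)
  have B: "(Basis :: (real ^ 'n) set) = range ?e" by (auto simp: Basis_vec_def)
  have "(\<integral>\<^sup>+l. (\<Prod>b\<in>Basis. f (inv ?e b) (l \<bullet> b)) \<partial>(lborel :: (real ^ 'n) measure))
      = (\<Prod>b\<in>Basis. \<integral>\<^sup>+x. f (inv ?e b) x \<partial>lborel)"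
    by (rule nn_integral_lborel_prod) auto
  then show ?thesis
    unfolding B prod.reindex[OF inj] o_def inv_f_f[OF inj] by (simp add: inner_axis)
qed

lemma nn_integral_gamma:
  fixes a c :: real
  assumes "0 < a" "0 < c"
  shows "(\<integral>\<^sup>+x. ennreal (indicator {0<..} x * (x powr (a - 1) * exp (- (c * x)))) \<partial>lborel)
    = ennreal (Gamma a / c powr a)"
    (is "?I = _")
proof -
  \<comment> \<open>The closed and the open half-line give the same integrand even at x = 0, because
    \<open>0 powr (a - 1)\<close> is 0.\<close>
  have eq: "indicator {0..} (0 + c * x) * (0 + c * x) powr (a - 1) / exp (0 + c * x)
      = c powr (a - 1) * (indicator {0<..} x * (x powr (a - 1) * exp (- (c * x))))" for x
    using assms
    by (cases "x = 0") (auto simp: indicator_def powr_mult zero_le_mult_iff exp_minus field_simps)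
  have "ennreal (Gamma a) = (\<integral>\<^sup>+t. ennreal (indicator {0..} t * t powr (a - 1) / exp t) \<partial>lborel)"
    by (rule Gamma_conv_nn_integral_real[OF assms(1)])
  also have "\<dots> = ennreal \<bar>c\<bar> * (\<integral>\<^sup>+x. ennreal (indicator {0..} (0 + c * x) * (0 + c * x) powr (a - 1) / exp (0 + c * x)) \<partial>lborel)"
    using assms by (intro nn_integral_real_affine) auto
  also have "\<dots> = ennreal \<bar>c\<bar> *
      (\<integral>\<^sup>+x. ennreal (c powr (a - 1) * (indicator {0<..} x * (x powr (a - 1) * exp (- (c * x))))) \<partial>lborel)"
    unfolding eq ..
  also have "(\<integral>\<^sup>+x. ennreal (c powr (a - 1) * (indicator {0<..} x * (x powr (a - 1) * exp (- (c * x))))) \<partial>lborel)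
      = ennreal (c powr (a - 1)) * ?I"
    by (subst nn_integral_cmult[symmetric]) (auto simp: ennreal_mult')
  finally have "ennreal (Gamma a) = ennreal c * ennreal (c powr (a - 1)) * ?I"
    using assms by (simp add: mult.assoc)
  also have "ennreal c * ennreal (c powr (a - 1)) = ennreal (c powr a)"
    using assms by (simp add: ennreal_mult'[symmetric] powr_mult_base)
  finally have "ennreal (1 / c powr a) * ennreal (Gamma a) = ennreal (1 / c powr a) * ennreal (c powr a) * ?I"
    by (simp add: mult.assoc)
  then show ?thesis
    using assms by (simp add: ennreal_mult'[symmetric])
qed

lemma indicator_pos_orthant: "indicator pos_orthant l = (\<Prod>i\<in>UNIV. indicator {0<..} (l $ i) :: real)"
proof (cases "l \<in> pos_orthant")
  case False
  then obtain i where "\<not> 0 < l $ i" by (auto simp: pos_orthant_def)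
  then have "(\<Prod>i\<in>UNIV. indicator {0<..} (l $ i) :: real) = 0"
    by (intro prod_zero bexI[of _ i]) auto
  then show ?thesis using False by simp
qed (simp add: pos_orthant_def)

lemma nn_integral_gamma_vec:
  fixes a c k :: "'n::finite \<Rightarrow> real"
  assumes "\<And>i. 0 < a i" "\<And>i. 0 < c i" "\<And>i. 0 \<le> k i"
  shows "(\<integral>\<^sup>+l. ennreal (indicator pos_orthant l *
        (\<Prod>i\<in>UNIV. k i * ((l $ i) powr (a i - 1) * exp (- (c i * l $ i))))) \<partial>lborel)
    = ennreal (\<Prod>i\<in>UNIV. k i * (Gamma (a i) / c i powr a i))"
proof -
  let ?f = "\<lambda>i x. ennreal (k i * (indicator {0<..} x * (x powr (a i - 1) * exp (- (c i * x)))))"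
  have "ennreal (indicator pos_orthant l * (\<Prod>i\<in>UNIV. k i * ((l $ i) powr (a i - 1) * exp (- (c i * l $ i)))))
      = (\<Prod>i\<in>UNIV. ?f i (l $ i))" for l :: "real ^ 'n"
    unfolding indicator_pos_orthant prod.distrib[symmetric] using assms
    by (subst prod_ennreal) (auto intro!: arg_cong[where f = ennreal] prod.cong)
  moreover have "(\<integral>\<^sup>+x. ?f i x \<partial>lborel) = ennreal (k i * (Gamma (a i) / c i powr a i))" for i
  proof -
    have "(\<integral>\<^sup>+x. ?f i x \<partial>lborel) = ennreal (k i) *
        (\<integral>\<^sup>+x. ennreal (indicator {0<..} x * (x powr (a i - 1) * exp (- (c i * x)))) \<partial>lborel)"
      using assms by (subst nn_integral_cmult[symmetric]) (auto simp: ennreal_mult')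
    then show ?thesis using assms by (simp add: nn_integral_gamma ennreal_mult'[symmetric])
  qed
  ultimately have "(\<integral>\<^sup>+l. ennreal (indicator pos_orthant l *
        (\<Prod>i\<in>UNIV. k i * ((l $ i) powr (a i - 1) * exp (- (c i * l $ i))))) \<partial>lborel)
      = (\<Prod>i\<in>UNIV. ennreal (k i * (Gamma (a i) / c i powr a i)))"
    using nn_integral_lborel_vec[of ?f] by simp
  also have "(\<Prod>i\<in>UNIV. ennreal (k i * (Gamma (a i) / c i powr a i)))
      = ennreal (\<Prod>i\<in>UNIV. k i * (Gamma (a i) / c i powr a i))"
    using assms by (intro prod_ennreal mult_nonneg_nonneg divide_nonneg_nonneg less_imp_le[OF Gamma_real_pos]) auto
  finally show ?thesis .
qed

section \<open>Joint and marginal masses under the gamma priors\<close>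

definition gamma_prior :: "real \<Rightarrow> real ^ 'n \<Rightarrow> real" where
  "gamma_prior \<beta> l = (\<Prod>i\<in>UNIV. (l $ i) powr (- 1 / 2) * exp (- (\<beta> * l $ i)))"

text \<open>The closed form of the integral of both sampling densities against
  \<open>gamma_prior\<close>, as \<open>nn_integral_joint\<close> shows;
  \<open>marginal_mass\<close> is its counterpart without y, and their quotient is the predictive
  distribution.\<close>

definition joint_mass :: "real \<Rightarrow> real ^ 'n \<Rightarrow> real ^ 'n \<Rightarrow> nat ^ 'n \<Rightarrow> nat ^ 'n \<Rightarrow> real" where
  "joint_mass \<beta> r s x y = (\<Prod>i\<in>UNIV. (r $ i) ^ (x $ i) / fact (x $ i) * ((s $ i) ^ (y $ i) / fact (y $ i))
      * gamma_mass (r $ i + s $ i + \<beta>) (x $ i + y $ i))"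

definition marginal_mass :: "real \<Rightarrow> real ^ 'n \<Rightarrow> nat ^ 'n \<Rightarrow> real" where
  "marginal_mass \<beta> r x = (\<Prod>i\<in>UNIV. (r $ i) ^ (x $ i) / fact (x $ i) * gamma_mass (r $ i + \<beta>) (x $ i))"

lemma gamma_predictive_eq:
  assumes "\<And>i. 0 < r $ i"
  shows "gamma_predictive \<beta> r s x y = joint_mass \<beta> r s x y / marginal_mass \<beta> r x"
  unfolding gamma_predictive_def joint_mass_def marginal_mass_def prod_dividef[symmetric]
  using assms by (intro prod.cong refl) (simp add: less_imp_neq[OF assms, symmetric])

text \<open>The indicator stands on both sides because merging natural powers with
  \<open>powr\<close> requires positive coordinates. The result is a product of gamma integrands of
  shape x + y + 1/2 and rate r + s + \<beta>.\<close>

lemma joint_integrand: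
  fixes r s :: "real ^ 'n"
  shows "indicator pos_orthant l * (poisson_vec r l x * poisson_vec s l y * gamma_prior \<beta> l)
    = indicator pos_orthant l * (\<Prod>i\<in>UNIV. (r $ i) ^ (x $ i) / fact (x $ i) * ((s $ i) ^ (y $ i) / fact (y $ i))
      * ((l $ i) powr ((real (x $ i + y $ i) + 1 / 2) - 1) * exp (- ((r $ i + s $ i + \<beta>) * l $ i))))"
proof (cases "l \<in> pos_orthant")
  case True
  then have "0 < l $ i" for i by (simp add: pos_orthant_def)
  then have "(l $ i) powr ((real (x $ i + y $ i) + 1 / 2) - 1)
      = (l $ i) ^ (x $ i) * (l $ i) ^ (y $ i) * (l $ i) powr (- 1 / 2)" for i
    by (simp add: powr_realpow[symmetric] powr_add[symmetric])
  moreover have "exp (- ((r $ i + s $ i + \<beta>) * l $ i))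
      = exp (- (r $ i * l $ i)) * exp (- (s $ i * l $ i)) * exp (- (\<beta> * l $ i))" for i
    by (simp add: exp_add[symmetric] algebra_simps)
  ultimately have "poisson_vec r l x * poisson_vec s l y * gamma_prior \<beta> l
    = (\<Prod>i\<in>UNIV. (r $ i) ^ (x $ i) / fact (x $ i) * ((s $ i) ^ (y $ i) / fact (y $ i))
      * ((l $ i) powr ((real (x $ i + y $ i) + 1 / 2) - 1) * exp (- ((r $ i + s $ i + \<beta>) * l $ i))))"
    unfolding poisson_vec_def gamma_prior_def prod.distrib[symmetric]
    by (intro prod.cong refl) (simp add: power_mult_distrib mult_ac)
  then show ?thesis by simp
qed simp

lemma marginal_integrand:
  fixes r :: "real ^ 'n"
  shows "indicator pos_orthant l * (poisson_vec r l x * gamma_prior \<beta> l)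
    = indicator pos_orthant l * (\<Prod>i\<in>UNIV. (r $ i) ^ (x $ i) / fact (x $ i)
      * ((l $ i) powr ((real (x $ i) + 1 / 2) - 1) * exp (- ((r $ i + \<beta>) * l $ i))))"
proof (cases "l \<in> pos_orthant")
  case True
  then have "0 < l $ i" for i by (simp add: pos_orthant_def)
  then have "(l $ i) powr ((real (x $ i) + 1 / 2) - 1) = (l $ i) ^ (x $ i) * (l $ i) powr (- 1 / 2)" for i
    by (simp add: powr_realpow[symmetric] powr_add[symmetric])
  moreover have "exp (- ((r $ i + \<beta>) * l $ i)) = exp (- (r $ i * l $ i)) * exp (- (\<beta> * l $ i))" for i
    by (simp add: exp_add[symmetric] algebra_simps)
  ultimately have "poisson_vec r l x * gamma_prior \<beta> l
    = (\<Prod>i\<in>UNIV. (r $ i) ^ (x $ i) / fact (x $ i)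
      * ((l $ i) powr ((real (x $ i) + 1 / 2) - 1) * exp (- ((r $ i + \<beta>) * l $ i))))"
    unfolding poisson_vec_def gamma_prior_def prod.distrib[symmetric]
    by (intro prod.cong refl) (simp add: power_mult_distrib mult_ac)
  then show ?thesis by simp
qed simp

lemma nn_integral_joint:
  fixes r s :: "real ^ 'n"
  assumes "\<And>i. 0 < r $ i" "\<And>i. 0 < s $ i" "0 \<le> \<beta>"
  shows "(\<integral>\<^sup>+l. ennreal (indicator pos_orthant l * (poisson_vec r l x * poisson_vec s l y * gamma_prior \<beta> l)) \<partial>lborel)
    = ennreal (joint_mass \<beta> r s x y)"
proof -
  have "0 \<le> r $ i" "0 \<le> s $ i" "0 < r $ i + s $ i + \<beta>" for i
    using assms(1,2)[of i] assms(3) by linarith+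
  then show ?thesis
    unfolding joint_integrand joint_mass_def gamma_mass_def by (intro nn_integral_gamma_vec) auto
qed

lemma nn_integral_marginal:
  fixes r :: "real ^ 'n"
  assumes "\<And>i. 0 < r $ i" "0 \<le> \<beta>"
  shows "(\<integral>\<^sup>+l. ennreal (indicator pos_orthant l * (poisson_vec r l x * gamma_prior \<beta> l)) \<partial>lborel)
    = ennreal (marginal_mass \<beta> r x)"
proof -
  have "0 \<le> r $ i" "0 < r $ i + \<beta>" for i
    using assms(1)[of i] assms(2) by linarith+
  then show ?thesis
    unfolding marginal_integrand marginal_mass_def gamma_mass_def by (intro nn_integral_gamma_vec) auto
qed

lemma mass_pos:
  fixes r s :: "real ^ 'n"
  assumes "\<And>i. 0 < r $ i" "\<And>i. 0 < s $ i" "0 \<le> \<beta>"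
  shows "0 < joint_mass \<beta> r s x y" "0 < marginal_mass \<beta> r x"
proof -
  have "0 < r $ i + s $ i + \<beta>" "0 < r $ i + \<beta>" for i using assms(1,2)[of i] assms(3) by linarith+
  then show "0 < joint_mass \<beta> r s x y" "0 < marginal_mass \<beta> r x"
    unfolding joint_mass_def marginal_mass_def
    by (intro prod_pos mult_pos_pos divide_pos_pos gamma_mass_pos ballI; simp add: assms)+
qed

lemma measurable_vec_functions [measurable]:
  "(\<lambda>l. indicator pos_orthant l :: real) \<in> borel_measurable (borel :: (real ^ 'n) measure)"
  "(\<lambda>l. poisson_vec r l x) \<in> borel_measurable (borel :: (real ^ 'n) measure)"
  "gamma_prior \<beta> \<in> borel_measurable (borel :: (real ^ 'n) measure)"
proof -
  have [measurable]: "(\<lambda>l. l $ i) \<in> borel_measurable (borel :: (real ^ 'n) measure)" for i by simp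
  show "(\<lambda>l. indicator pos_orthant l :: real) \<in> borel_measurable (borel :: (real ^ 'n) measure)"
    unfolding indicator_pos_orthant by measurable
  show "(\<lambda>l. poisson_vec r l x) \<in> borel_measurable (borel :: (real ^ 'n) measure)"
    unfolding poisson_vec_def by measurable
  show "gamma_prior \<beta> \<in> borel_measurable (borel :: (real ^ 'n) measure)"
    unfolding gamma_prior_def[abs_def] by measurable
qed

lemma gamma_prior_nonneg: "0 \<le> gamma_prior \<beta> l"
  unfolding gamma_prior_def by (intro prod_nonneg) auto

lemma jeffreys_predictive_eq:
  fixes r s :: "real ^ 'n"
  assumes "\<And>i. 0 < r $ i" "\<And>i. 0 < s $ i"
  shows "jeffreys_predictive r s x y = gamma_predictive 0 r s x y"
proof -
  have prior: "jeffreys_prior = gamma_prior 0"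
    by (rule ext) (simp add: jeffreys_prior_def gamma_prior_def)
  have nn: "0 \<le> indicator pos_orthant l * (poisson_vec r l x * poisson_vec s l y * gamma_prior 0 l)"
    "0 \<le> indicator pos_orthant l * (poisson_vec r l x * gamma_prior 0 l)" for l
  proof -
    have "0 \<le> poisson_vec r l x" "0 \<le> poisson_vec s l y" if "l \<in> pos_orthant"
      using that poisson_vec_pos[of _ l] assms by (auto simp: pos_orthant_def intro!: less_imp_le)
    then show "0 \<le> indicator pos_orthant l * (poisson_vec r l x * poisson_vec s l y * gamma_prior 0 l)"
      "0 \<le> indicator pos_orthant l * (poisson_vec r l x * gamma_prior 0 l)"
      using gamma_prior_nonneg[of 0 l] by (cases "l \<in> pos_orthant"; simp)+
  qed
  have "(LINT l:pos_orthant|lborel. poisson_vec r l x * poisson_vec s l y * jeffreys_prior l) = joint_mass 0 r s x y"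
    unfolding set_lebesgue_integral_def prior real_scaleR_def
    using nn(1) less_imp_le[OF mass_pos(1)[OF assms, of 0 x y]]
    by (subst integral_eq_nn_integral) (auto simp: nn_integral_joint[OF assms])
  moreover have "(LINT l:pos_orthant|lborel. poisson_vec r l x * jeffreys_prior l) = marginal_mass 0 r x"
    unfolding set_lebesgue_integral_def prior real_scaleR_def
    using nn(2) less_imp_le[OF mass_pos(2)[OF assms, of 0 x]]
    by (subst integral_eq_nn_integral) (auto simp: nn_integral_marginal[OF assms(1)])
  ultimately show ?thesis
    unfolding jeffreys_predictive_def by (simp add: gamma_predictive_eq assms)
qed

section \<open>The upper bound for the Jeffreys predictive distribution\<close>

lemma kl_risk_jeffreys_less:
  fixes r s :: "real ^ 'n"
  assumes "\<And>i. 0 < r $ i" "\<And>i. 0 < s $ i" "l \<in> pos_orthant"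
  shows "kl_risk r s (jeffreys_predictive r s) l
    < ereal (0.52 * (\<Sum>i\<in>UNIV. ln ((r $ i + s $ i) / r $ i)))"
proof -
  have l: "0 < l $ i" for i using assms(3) by (simp add: pos_orthant_def)
  have "kl_risk r s (jeffreys_predictive r s) l = kl_risk r s (gamma_predictive 0 r s) l"
    unfolding kl_risk_def jeffreys_predictive_eq[OF assms(1,2)] ..
  also have "\<dots> = ereal (\<Sum>i\<in>UNIV. coordinate_risk 0 (r $ i) (s $ i) (l $ i))"
    by (rule kl_risk_gamma_predictive[OF assms(1,2) l]) simp
  also have "\<dots> < ereal (\<Sum>i\<in>UNIV. 0.52 * ln ((r $ i + s $ i) / r $ i))"
  proof -
    \<comment> \<open>The closed form contributes 1/2 and \<open>gamma_gap_diff_less\<close>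
      contributes 1/50.\<close>
    have "coordinate_risk 0 (r $ i) (s $ i) (l $ i) < 0.52 * ln ((r $ i + s $ i) / r $ i)" for i
    proof -
      have pos: "0 < r $ i" "0 < s $ i" "0 < l $ i" using assms l by auto
      then have "0 < r $ i * l $ i" "r $ i * l $ i < (r $ i + s $ i) * l $ i" by auto
      from gamma_gap_diff_less[OF this] show ?thesis
        using pos by (simp add: coordinate_risk_def)
    qed
    then show ?thesis unfolding less_ereal.simps by (intro sum_strict_mono) auto
  qed
  finally show ?thesis by (simp add: sum_distrib_left)
qed

section \<open>The Bayesian lower bound\<close>

text \<open>By ln z \<le> z - 1 the map x * ln (1 + \<beta> / x) is nondecreasing. This gives the
  sign of the \<beta>-term in \<open>coordinate_risk\<close>, which can then be dropped from lower
  bounds.\<close>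

lemma mult_ln_add_div_mono:
  fixes a b \<beta> :: real
  assumes "0 < a" "a \<le> b" "0 \<le> \<beta>"
  shows "a * ln ((a + \<beta>) / a) \<le> b * ln ((b + \<beta>) / b)"
proof -
  let ?f = "\<lambda>x. x * (ln (x + \<beta>) - ln x)"
  have "?f a \<le> ?f b"
  proof (rule DERIV_nonneg_imp_nondecreasing[OF assms(2)])
    fix x assume "a \<le> x" "x \<le> b"
    then have x: "0 < x" "0 < x + \<beta>" using assms by auto
    have "(?f has_real_derivative (ln (x + \<beta>) - ln x) + x * (1 / (x + \<beta>) - 1 / x)) (at x)"
      using x by (auto intro!: derivative_eq_intros)
    moreover have "ln (x / (x + \<beta>)) \<le> x / (x + \<beta>) - 1"
      using x by (intro ln_le_minus_one) auto
    then have "0 \<le> (ln (x + \<beta>) - ln x) + x * (1 / (x + \<beta>) - 1 / x)"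
      using x by (simp add: ln_divide_pos right_diff_distrib)
    ultimately show "\<exists>y. (?f has_real_derivative y) (at x) \<and> 0 \<le> y" by blast
  qed
  then show ?thesis using assms by (simp add: ln_divide_pos)
qed

lemma coordinate_risk_ge:
  assumes "0 < r" "0 < s" "0 < l" "0 \<le> \<beta>"
  shows "1 / 2 * ln ((r + s + \<beta>) / (r + \<beta>)) - 4 * r powr (- 1 / 4) * l powr (- 1 / 4) \<le> coordinate_risk \<beta> r s l"
proof -
  have "- 4 * (r * l) powr (- 1 / 4) \<le> gamma_gap (r * l) - gamma_gap ((r + s) * l)"
    using assms by (intro gamma_gap_diff_ge) auto
  moreover have "(r * l) powr (- 1 / 4) = r powr (- 1 / 4) * l powr (- 1 / 4)"
    using assms by (simp add: powr_mult)
  moreover have "0 \<le> l * ((r + s) * ln ((r + s + \<beta>) / (r + s)) - r * ln ((r + \<beta>) / r))"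
    using mult_ln_add_div_mono[of r "r + s" \<beta>] assms by simp
  ultimately show ?thesis unfolding coordinate_risk_def by linarith
qed

text \<open>The mean at l of the ratio of q to the Bayesian predictive density. It takes values in
  \<open>ennreal\<close> because it may be infinite at some l; its integral against the prior weight
  is known exactly.\<close>

definition predictive_excess ::
  "real \<Rightarrow> real ^ 'n \<Rightarrow> real ^ 'n \<Rightarrow> (nat ^ 'n \<Rightarrow> (nat ^ 'n) pmf) \<Rightarrow> real ^ 'n \<Rightarrow> ennreal" where
  "predictive_excess \<beta> r s q l = (\<integral>\<^sup>+x. \<integral>\<^sup>+y. ennreal (poisson_vec r l x *
      (poisson_vec s l y * (pmf (q x) y / gamma_predictive \<beta> r s x y))) \<partial>count_space UNIV \<partial>count_space UNIV)"

lemma integrable_count_space_nonneg: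
  fixes f :: "'a \<Rightarrow> real"
  assumes "\<And>x. 0 \<le> f x" "(\<integral>\<^sup>+x. ennreal (f x) \<partial>count_space UNIV) < \<infinity>"
  shows "integrable (count_space UNIV) f"
  using assms by (intro integrableI_nonneg) auto

text \<open>By \<open>ln (b / q) \<ge> 1 - q / b\<close> the risk of \<open>q\<close> exceeds that of the Bayesian predictive
  distribution \<open>b\<close> by at least \<open>1 - predictive_excess\<close>; the weighted integral of the latter is
  computed by Tonelli, so no signed integrals have to be interchanged.\<close>

lemma kl_risk_ge_excess:
  fixes r s l :: "real ^ 'n"
  assumes r: "\<And>i. 0 < r $ i" and s: "\<And>i. 0 < s $ i" and l: "\<And>i. 0 < l $ i" and \<beta>: "0 \<le> \<beta>"
    and R: "kl_risk r s (\<lambda>x y. pmf (q x) y) l \<le> ereal R"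
  shows "ennreal ((\<Sum>i\<in>UNIV. coordinate_risk \<beta> (r $ i) (s $ i) (l $ i)) + 1 - R) \<le> predictive_excess \<beta> r s q l"
proof (cases "predictive_excess \<beta> r s q l = \<infinity>")
  case False
  define b where "b = gamma_predictive \<beta> r s"
  define P where "P = poisson_vec_pmf r l"
  define P' where "P' = poisson_vec_pmf s l"
  have P: "poisson_vec r l x = pmf P x" "poisson_vec s l x = pmf P' x" for x
    unfolding P_def P'_def using r s l by (simp_all add: pmf_poisson_vec_pmf)
  have Ppos: "0 < pmf P x" "0 < pmf P' x" for x
    unfolding P[symmetric] using r s l by (auto intro: poisson_vec_pos)
  have bpos: "0 < b x y" for x y unfolding b_def using r s \<beta> by (rule gamma_predictive_pos)
  define K where "K x y = (\<Sum>i\<in>UNIV. log_ratio \<beta> (r $ i) (s $ i) (l $ i) (x $ i) (y $ i))" for x y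
  define H where "H x = (\<Sum>i\<in>UNIV. poisson_mean (log_ratio \<beta> (r $ i) (s $ i) (l $ i) (x $ i)) (s $ i * l $ i))" for x
  note inner = kl_risk_gamma_predictive_inner[OF r s l \<beta>, folded P_def P'_def K_def H_def[abs_def]]
  define S where "S x = (\<integral>\<^sup>+y. ennreal (pmf P' y * (pmf (q x) y / b x y)) \<partial>count_space UNIV)" for x
  have excess: "predictive_excess \<beta> r s q l = (\<integral>\<^sup>+x. ennreal (pmf P x) * S x \<partial>count_space UNIV)"
    unfolding predictive_excess_def P S_def b_def[symmetric]
    by (simp only: ennreal_mult'[OF pmf_nonneg] nn_integral_cmult borel_measurable_count_space)
  have fin: "ennreal (pmf P x) * S x \<noteq> \<infinity>" for x
    using nn_integral_ge_point[of x UNIV "\<lambda>x. ennreal (pmf P x) * S x"] False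
    unfolding excess[symmetric] by (auto simp: top_unique)
  \<comment> \<open>All Poisson weights are strictly positive, so finiteness of the weighted term
    passes to \<open>S x\<close> at every x.\<close>
  have S_fin: "S x < \<infinity>" for x
    using fin[of x] Ppos(1)[of x] by (auto simp: ennreal_mult_eq_top_iff less_top)
  define \<sigma> where "\<sigma> x = enn2real (S x)" for x
  have S: "S x = ennreal (\<sigma> x)" for x using S_fin[of x] by (simp add: \<sigma>_def)
  have \<sigma>: "0 \<le> \<sigma> x" for x by (simp add: \<sigma>_def)
  have int_q: "integrable (count_space UNIV) (\<lambda>y. pmf P' y * (pmf (q x) y / b x y))" for x
    using S_fin[of x] less_imp_le[OF bpos] unfolding S_def by (intro integrable_count_space_nonneg) auto
  have sum_q: "(\<integral>y. pmf P' y * (pmf (q x) y / b x y) \<partial>count_space UNIV) = \<sigma> x" for x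
    unfolding \<sigma>_def S_def using less_imp_le[OF bpos] by (intro integral_eq_nn_integral) auto
  have kl_ge: "ereal (pmf P' y * (K x y + 1) - pmf P' y * (pmf (q x) y / b x y)) \<le> kl_term (pmf P' y) (pmf (q x) y)" for x y
  proof (cases "pmf (q x) y = 0")
    case True
    then show ?thesis using Ppos(2)[of y] by (simp add: kl_term_def)
  next
    case False
    then have q: "0 < pmf (q x) y" by (simp add: pmf_pos)
    have K: "K x y = ln (pmf P' y / b x y)"
      unfolding K_def b_def P[symmetric] by (rule ln_poisson_vec_div_gamma_predictive[OF r s l \<beta>, symmetric])
    have "ln (pmf (q x) y / b x y) \<le> pmf (q x) y / b x y - 1"
      using q bpos by (intro ln_le_minus_one) auto
    then have "K x y + 1 - pmf (q x) y / b x y \<le> ln (pmf P' y / pmf (q x) y)"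
      unfolding K using q bpos[of x y] Ppos(2)[of y] by (simp add: ln_divide_pos)
    then have "pmf P' y * (K x y + 1 - pmf (q x) y / b x y) \<le> pmf P' y * ln (pmf P' y / pmf (q x) y)"
      by (intro mult_left_mono) auto
    then show ?thesis using q Ppos(2)[of y] by (simp add: kl_term_def right_diff_distrib)
  qed
  have int_K: "integrable (measure_pmf P') (\<lambda>y. K x y + 1)"
    and exp_K: "measure_pmf.expectation P' (\<lambda>y. K x y + 1) = H x + 1" for x
    using inner(1,2)[of x] by (simp_all add: H_def)
  have inner_ge: "ereal (H x + 1 - \<sigma> x) \<le> ext_sum (\<lambda>y. kl_term (pmf P' y) (pmf (q x) y))" for x
  proof -
    have i: "integrable (count_space UNIV) (\<lambda>y. pmf P' y * (K x y + 1))"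
      using int_K by (simp only: integrable_measure_pmf_iff)
    \<comment> \<open>The minorant is a difference of two integrable families, so its extended sum
      is an ordinary real number; monotonicity then carries it to terms that may be
      infinite.\<close>
    have "ext_sum (\<lambda>y. ereal (pmf P' y * (K x y + 1) - pmf P' y * (pmf (q x) y / b x y))) = ereal (H x + 1 - \<sigma> x)"
      using exp_K[of x] unfolding expectation_pmf_eq_count_space
      by (subst ext_sum_ereal[OF Bochner_Integration.integrable_diff[OF i int_q]])
        (simp only: Bochner_Integration.integral_diff[OF i int_q] sum_q)
    then show ?thesis by (rule subst) (rule ext_sum_mono, rule kl_ge)
  qed
  have int_\<sigma>: "integrable (count_space UNIV) (\<lambda>x. pmf P x * \<sigma> x)"
    and sum_\<sigma>: "(\<integral>x. pmf P x * \<sigma> x \<partial>count_space UNIV) = enn2real (predictive_excess \<beta> r s q l)"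
  proof -
    have e: "predictive_excess \<beta> r s q l = (\<integral>\<^sup>+x. ennreal (pmf P x * \<sigma> x) \<partial>count_space UNIV)"
      unfolding excess S by (simp add: ennreal_mult' \<sigma>)
    show "integrable (count_space UNIV) (\<lambda>x. pmf P x * \<sigma> x)"
      using False \<sigma> unfolding e by (intro integrable_count_space_nonneg) (auto simp: less_top)
    show "(\<integral>x. pmf P x * \<sigma> x \<partial>count_space UNIV) = enn2real (predictive_excess \<beta> r s q l)"
      unfolding e using \<sigma> by (intro integral_eq_nn_integral) auto
  qed
  have int_H: "integrable (measure_pmf P) (\<lambda>x. H x + 1)"
    and exp_H: "measure_pmf.expectation P (\<lambda>x. H x + 1) = (\<Sum>i\<in>UNIV. coordinate_risk \<beta> (r $ i) (s $ i) (l $ i)) + 1"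
    using inner(3,4) by simp_all
  have i: "integrable (count_space UNIV) (\<lambda>x. pmf P x * (H x + 1))"
    using int_H by (simp only: integrable_measure_pmf_iff)
  have "ereal ((\<Sum>i\<in>UNIV. coordinate_risk \<beta> (r $ i) (s $ i) (l $ i)) + 1 - enn2real (predictive_excess \<beta> r s q l))
      = ext_sum (\<lambda>x. ereal (pmf P x * (H x + 1) - pmf P x * \<sigma> x))"
    using exp_H unfolding expectation_pmf_eq_count_space
    by (subst ext_sum_ereal[OF Bochner_Integration.integrable_diff[OF i int_\<sigma>]])
      (simp only: Bochner_Integration.integral_diff[OF i int_\<sigma>] sum_\<sigma>)
  also have "\<dots> \<le> kl_risk r s (\<lambda>x y. pmf (q x) y) l"
    unfolding kl_risk_def P
  proof (rule ext_sum_mono)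
    fix x
    have "ereal (pmf P x) * ereal (H x + 1 - \<sigma> x) \<le> ereal (pmf P x) * ext_sum (\<lambda>y. kl_term (pmf P' y) (pmf (q x) y))"
      by (intro ereal_mult_left_mono inner_ge) simp
    then show "ereal (pmf P x * (H x + 1) - pmf P x * \<sigma> x)
        \<le> ereal (pmf P x) * ext_sum (\<lambda>y. kl_term (pmf P' y) (pmf (q x) y))"
      by (simp add: right_diff_distrib)
  qed
  also note R
  finally have "(\<Sum>i\<in>UNIV. coordinate_risk \<beta> (r $ i) (s $ i) (l $ i)) + 1 - R \<le> enn2real (predictive_excess \<beta> r s q l)"
    by simp
  then have "ennreal ((\<Sum>i\<in>UNIV. coordinate_risk \<beta> (r $ i) (s $ i) (l $ i)) + 1 - R)
      \<le> ennreal (enn2real (predictive_excess \<beta> r s q l))"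
    by (rule ennreal_leI)
  also have "\<dots> = predictive_excess \<beta> r s q l" using False by (simp add: less_top)
  finally show ?thesis .
qed simp

lemma nn_integral_poisson_vec:
  assumes "\<And>i. 0 < r $ i" "\<And>i. 0 < l $ i"
  shows "(\<integral>\<^sup>+x. ennreal (poisson_vec r l x) \<partial>count_space UNIV) = 1"
  using nn_integral_pmf[where p = "poisson_vec_pmf r l" and A = UNIV] assms
  by (simp add: pmf_poisson_vec_pmf measure_pmf.emeasure_space_1[simplified])

lemma borel_measurable_nn_integral_count_space:
  fixes f :: "'i::countable \<Rightarrow> 'a \<Rightarrow> ennreal"
  assumes [measurable]: "\<And>i. f i \<in> borel_measurable M"
  shows "(\<lambda>x. \<integral>\<^sup>+i. f i x \<partial>count_space UNIV) \<in> borel_measurable M"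
proof -
  interpret sigma_finite_measure "count_space (UNIV :: 'i set)"
    by (rule sigma_finite_measure_count_space)
  have "(\<lambda>(x, i). f i x) \<in> borel_measurable (M \<Otimes>\<^sub>M count_space UNIV)"
    using measurable_compose_countable[of "\<lambda>i p. f i (fst p)" "M \<Otimes>\<^sub>M count_space UNIV" borel snd]
    by (simp add: split_beta)
  then show ?thesis by (rule borel_measurable_nn_integral)
qed

text \<open>By Tonelli the integral over l can be taken first. It gives \<open>joint_mass\<close>,
  which is \<open>marginal_mass\<close> times the predictive density b; the ratio q / b turns this
  into \<open>marginal_mass\<close> times q, and q sums to 1 over y. Whatever q is, the averaged
  excess equals the prior mass: Bayes optimality in a form without logarithms.\<close>

lemma nn_integral_predictive_excess:
  fixes r s :: "real ^ 'n"
  assumes r: "\<And>i. 0 < r $ i" and s: "\<And>i. 0 < s $ i" and \<beta>: "0 \<le> \<beta>"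
  shows "(\<integral>\<^sup>+l. ennreal (indicator pos_orthant l * gamma_prior \<beta> l) * predictive_excess \<beta> r s q l \<partial>lborel)
    = (\<integral>\<^sup>+l. ennreal (indicator pos_orthant l * gamma_prior \<beta> l) \<partial>(lborel :: (real ^ 'n) measure))"
proof -
  let ?w = "\<lambda>l :: real ^ 'n. indicator pos_orthant l * gamma_prior \<beta> l"
  let ?C = "count_space UNIV :: (nat ^ 'n) measure"
  define b where "b = gamma_predictive \<beta> r s"
  have bpos: "0 < b x y" for x y unfolding b_def using r s \<beta> by (rule gamma_predictive_pos)
  have w: "0 \<le> ?w l" for l using gamma_prior_nonneg[of \<beta> l] by simp
  have pv: "0 \<le> poisson_vec r l x" "0 \<le> poisson_vec s l x" if "l \<in> pos_orthant" for l x
    using that r s by (auto intro!: less_imp_le poisson_vec_pos simp: pos_orthant_def)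
  have eq1: "ennreal (?w l) * predictive_excess \<beta> r s q l = (\<integral>\<^sup>+x. \<integral>\<^sup>+y.
      ennreal (pmf (q x) y / b x y) * ennreal (indicator pos_orthant l * (poisson_vec r l x * poisson_vec s l y * gamma_prior \<beta> l)) \<partial>?C \<partial>?C)" for l
  proof (cases "l \<in> pos_orthant")
    case True
    have "ennreal (?w l) * ennreal (poisson_vec r l x * (poisson_vec s l y * (pmf (q x) y / b x y)))
        = ennreal (pmf (q x) y / b x y) * ennreal (indicator pos_orthant l * (poisson_vec r l x * poisson_vec s l y * gamma_prior \<beta> l))" for x y
      using w[of l] True pv[OF True] less_imp_le[OF bpos[of x y]] gamma_prior_nonneg[of \<beta> l]
      by (simp add: ennreal_mult'[symmetric] mult_ac)
    then show ?thesis
      unfolding predictive_excess_def b_def[symmetric]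
      by (simp add: nn_integral_cmult[symmetric])
  qed simp
  \<comment> \<open>This is where b has to be the predictive distribution of the very prior used as
    weight.\<close>
  have J: "ennreal (pmf (q x) y / b x y) * ennreal (joint_mass \<beta> r s x y) = ennreal (marginal_mass \<beta> r x) * ennreal (pmf (q x) y)" for x y
  proof -
    have "pmf (q x) y / b x y * joint_mass \<beta> r s x y = marginal_mass \<beta> r x * pmf (q x) y"
      using mass_pos(1)[OF r s \<beta>, of x y] mass_pos(2)[OF r s \<beta>, of x] unfolding b_def gamma_predictive_eq[OF r] by (simp add: field_simps)
    then show ?thesis
      using mass_pos(1)[OF r s \<beta>, of x y] mass_pos(2)[OF r s \<beta>, of x] less_imp_le[OF bpos[of x y]] by (simp add: ennreal_mult'[symmetric])
  qed
  have "(\<integral>\<^sup>+l. ennreal (?w l) * predictive_excess \<beta> r s q l \<partial>lborel) = (\<integral>\<^sup>+x. \<integral>\<^sup>+y. \<integral>\<^sup>+l.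
      ennreal (pmf (q x) y / b x y) * ennreal (indicator pos_orthant l * (poisson_vec r l x * poisson_vec s l y * gamma_prior \<beta> l)) \<partial>lborel \<partial>?C \<partial>?C)"
    unfolding eq1
    by (subst nn_integral_count_space_nn_integral, simp,
        intro borel_measurable_nn_integral_count_space, measurable)
       (subst nn_integral_count_space_nn_integral, auto)
  also have "\<dots> = (\<integral>\<^sup>+x. \<integral>\<^sup>+y. ennreal (marginal_mass \<beta> r x) * ennreal (pmf (q x) y) \<partial>?C \<partial>?C)"
    by (subst nn_integral_cmult, measurable) (simp add: nn_integral_joint[OF r s \<beta>] J)
  also have "\<dots> = (\<integral>\<^sup>+x. ennreal (marginal_mass \<beta> r x) \<partial>?C)"
    by (simp add: nn_integral_cmult nn_integral_pmf measure_pmf.emeasure_space_1[simplified])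
  also have "\<dots> = (\<integral>\<^sup>+x. \<integral>\<^sup>+l. ennreal (indicator pos_orthant l * (poisson_vec r l x * gamma_prior \<beta> l)) \<partial>lborel \<partial>?C)"
    by (simp add: nn_integral_marginal[OF r \<beta>])
  also have "\<dots> = (\<integral>\<^sup>+l. \<integral>\<^sup>+x. ennreal (indicator pos_orthant l * (poisson_vec r l x * gamma_prior \<beta> l)) \<partial>?C \<partial>lborel)"
    by (subst nn_integral_count_space_nn_integral) auto
  also have "\<dots> = (\<integral>\<^sup>+l. ennreal (?w l) \<partial>lborel)"
  proof (rule nn_integral_cong)
    fix l :: "real ^ 'n"
    show "(\<integral>\<^sup>+x. ennreal (indicator pos_orthant l * (poisson_vec r l x * gamma_prior \<beta> l)) \<partial>?C) = ennreal (?w l)"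
    proof (cases "l \<in> pos_orthant")
      case True
      then have "\<And>i. 0 < l $ i" by (simp add: pos_orthant_def)
      have "(\<integral>\<^sup>+x. ennreal (indicator pos_orthant l * (poisson_vec r l x * gamma_prior \<beta> l)) \<partial>?C)
          = (\<integral>\<^sup>+x. ennreal (gamma_prior \<beta> l) * ennreal (poisson_vec r l x) \<partial>?C)"
        using True gamma_prior_nonneg[of \<beta> l] by (simp add: ennreal_mult'[symmetric] mult_ac)
      also have "\<dots> = ennreal (gamma_prior \<beta> l)"
        using nn_integral_poisson_vec[OF r \<open>\<And>i. 0 < l $ i\<close>] by (simp add: nn_integral_cmult)
      finally show ?thesis using True by simp
    qed simp
  qed
  finally show ?thesis .
qed

text \<open>The factor with exponent -1/4 lowers the gamma shape of one coordinate from 1/2 to 1/4,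
  which is still positive. Relative to the prior mass W this costs a fixed factor times \<beta> powr
  (1/4).\<close>

lemma nn_integral_gamma_prior_powr:
  fixes i :: "'n::finite"
  assumes "0 < \<beta>"
  defines "W \<equiv> \<Prod>j\<in>(UNIV :: 'n set). Gamma (1 / 2) / \<beta> powr (1 / 2)"
  shows "(\<integral>\<^sup>+l. ennreal (indicator pos_orthant l * gamma_prior \<beta> l) \<partial>(lborel :: (real ^ 'n) measure)) = ennreal W"
    and "(\<integral>\<^sup>+l. ennreal (indicator pos_orthant l * gamma_prior \<beta> l) * ennreal (l $ i powr (- 1 / 4)) \<partial>(lborel :: (real ^ 'n) measure))
      = ennreal (W * (Gamma (1 / 4) / Gamma (1 / 2) * \<beta> powr (1 / 4)))"
proof -
  have "(\<integral>\<^sup>+l. ennreal (indicator pos_orthant l * (\<Prod>j\<in>(UNIV :: 'n set). 1 * ((l $ j) powr (1 / 2 - 1) * exp (- (\<beta> * l $ j))))) \<partial>lborel)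
      = ennreal (\<Prod>j\<in>(UNIV :: 'n set). 1 * (Gamma (1 / 2) / \<beta> powr (1 / 2)))"
    using assms by (intro nn_integral_gamma_vec) auto
  then show "(\<integral>\<^sup>+l. ennreal (indicator pos_orthant l * gamma_prior \<beta> l) \<partial>(lborel :: (real ^ 'n) measure)) = ennreal W"
    by (simp add: gamma_prior_def W_def)
  \<comment> \<open>The vector of gamma shapes, lowered only at the coordinate i.\<close>
  define a where "a j = (if j = i then 1 / 4 else 1 / 2 :: real)" for j
  have "ennreal (indicator pos_orthant l * gamma_prior \<beta> l) * ennreal (l $ i powr (- 1 / 4))
      = ennreal (indicator pos_orthant l * (\<Prod>j\<in>UNIV. 1 * ((l $ j) powr (a j - 1) * exp (- (\<beta> * l $ j)))))"
    for l :: "real ^ 'n"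
  proof (cases "l \<in> pos_orthant")
    case True
    have "gamma_prior \<beta> l * l $ i powr (- 1 / 4) = (\<Prod>j\<in>UNIV. ((l $ j) powr (- 1 / 2) * exp (- (\<beta> * l $ j)))
        * (if j = i then l $ j powr (- 1 / 4) else 1))"
      unfolding prod.distrib[of _ "\<lambda>j. if j = i then _ j else 1"] gamma_prior_def by simp
    also have "\<dots> = (\<Prod>j\<in>UNIV. 1 * ((l $ j) powr (a j - 1) * exp (- (\<beta> * l $ j))))"
      by (intro prod.cong refl) (auto simp: a_def powr_add[symmetric])
    finally show ?thesis using True gamma_prior_nonneg[of \<beta> l] by (simp add: ennreal_mult'[symmetric])
  qed simp
  then have "(\<integral>\<^sup>+l. ennreal (indicator pos_orthant l * gamma_prior \<beta> l) * ennreal (l $ i powr (- 1 / 4)) \<partial>(lborel :: (real ^ 'n) measure))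
      = ennreal (\<Prod>j\<in>(UNIV :: 'n set). 1 * (Gamma (a j) / \<beta> powr (a j)))"
    using assms by (simp only:) (intro nn_integral_gamma_vec, auto simp: a_def)
  also have "(\<Prod>j\<in>(UNIV :: 'n set). 1 * (Gamma (a j) / \<beta> powr (a j))) = W * (Gamma (1 / 4) / Gamma (1 / 2) * \<beta> powr (1 / 4))"
  proof -
    have G: "Gamma (1 / 2 :: real) \<noteq> 0" by (rule less_imp_neq[symmetric, OF Gamma_real_pos]) simp
    have eq: "Gamma (a j) / \<beta> powr (a j) = (Gamma (1 / 2) / \<beta> powr (1 / 2))
        * (if j = i then Gamma (1 / 4) / Gamma (1 / 2) * \<beta> powr (1 / 4) else 1)" for j
      using assms(1) G by (simp add: a_def field_simps powr_add[symmetric])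
    show ?thesis unfolding mult_1 eq prod.distrib W_def by simp
  qed
  finally show "(\<integral>\<^sup>+l. ennreal (indicator pos_orthant l * gamma_prior \<beta> l) * ennreal (l $ i powr (- 1 / 4)) \<partial>(lborel :: (real ^ 'n) measure))
      = ennreal (W * (Gamma (1 / 4) / Gamma (1 / 2) * \<beta> powr (1 / 4)))" .
qed


section \<open>The bound for a fixed prior and its limit\<close>

lemma ennreal_add_le: "0 \<le> b \<Longrightarrow> ennreal (a + b) \<le> ennreal a + ennreal b"
  by (cases "0 \<le> a") (auto simp: ennreal_neg intro!: ennreal_leI)

text \<open>A uniform risk bound R gives at each l that c + 1 - R is at most the excess plus error
  terms in negative powers of the coordinates. Integrated against the prior, the excess contributes
  exactly the prior mass W, which cancels the 1.\<close>

lemma bayes_lower_bound: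
  fixes r s :: "real ^ 'n"
  assumes r: "\<And>i. 0 < r $ i" and s: "\<And>i. 0 < s $ i" and \<beta>: "0 < \<beta>"
    and R: "\<And>l. l \<in> pos_orthant \<Longrightarrow> kl_risk r s (\<lambda>x y. pmf (q x) y) l \<le> ereal R"
  shows "1 / 2 * (\<Sum>i\<in>UNIV. ln ((r $ i + s $ i + \<beta>) / (r $ i + \<beta>)))
    - (\<Sum>i\<in>UNIV. 4 * r $ i powr (- 1 / 4)) * (Gamma (1 / 4) / Gamma (1 / 2) * \<beta> powr (1 / 4)) \<le> R"
proof -
  define c where "c = 1 / 2 * (\<Sum>i\<in>UNIV. ln ((r $ i + s $ i + \<beta>) / (r $ i + \<beta>)))"
  define k where "k i = 4 * r $ i powr (- 1 / 4)" for i
  define g :: real where "g = Gamma (1 / 4) / Gamma (1 / 2) * \<beta> powr (1 / 4)"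
  define W where "W = (\<Prod>j\<in>(UNIV :: 'n set). Gamma (1 / 2) / \<beta> powr (1 / 2))"
  define w where "w l = indicator pos_orthant l * gamma_prior \<beta> l" for l :: "real ^ 'n"
  have w: "0 \<le> w l" for l using gamma_prior_nonneg[of \<beta> l] by (simp add: w_def)
  have w_meas [measurable]: "w \<in> borel_measurable borel" unfolding w_def[abs_def] by measurable
  have k: "0 \<le> k i" for i by (simp add: k_def)
  have g: "0 \<le> g" unfolding g_def by (intro mult_nonneg_nonneg divide_nonneg_nonneg less_imp_le[OF Gamma_real_pos]) auto
  have W: "0 < W" unfolding W_def using \<beta> by (intro prod_pos divide_pos_pos Gamma_real_pos ballI) auto
  have int_w: "(\<integral>\<^sup>+l. ennreal (w l) \<partial>lborel) = ennreal W"
    "(\<integral>\<^sup>+l. ennreal (w l) * ennreal (l $ i powr (- 1 / 4)) \<partial>lborel) = ennreal (W * g)" for i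
    unfolding w_def W_def g_def by (rule nn_integral_gamma_prior_powr[OF \<beta>])+
  \<comment> \<open>Every subtraction is moved to the left or inside a single
    \<open>ennreal\<close>, so the inequality can be integrated without integrability conditions;
    cutting a negative c + 1 - R off at 0 only weakens it.\<close>
  have pointwise: "ennreal (w l) * ennreal (c + 1 - R) \<le> ennreal (w l) * predictive_excess \<beta> r s q l
      + (\<Sum>i\<in>UNIV. ennreal (k i) * (ennreal (w l) * ennreal (l $ i powr (- 1 / 4))))" for l
  proof (cases "l \<in> pos_orthant")
    case True
    then have l: "0 < l $ i" for i by (simp add: pos_orthant_def)
    have "c - (\<Sum>i\<in>UNIV. k i * l $ i powr (- 1 / 4)) \<le> (\<Sum>i\<in>UNIV. coordinate_risk \<beta> (r $ i) (s $ i) (l $ i))"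
      unfolding c_def k_def sum_distrib_left sum_subtractf[symmetric] using \<beta>
      by (intro sum_mono coordinate_risk_ge r s l) auto
    then have "c + 1 - R \<le> (\<Sum>i\<in>UNIV. coordinate_risk \<beta> (r $ i) (s $ i) (l $ i)) + 1 - R
        + (\<Sum>i\<in>UNIV. k i * l $ i powr (- 1 / 4))" by linarith
    then have "ennreal (c + 1 - R) \<le> ennreal ((\<Sum>i\<in>UNIV. coordinate_risk \<beta> (r $ i) (s $ i) (l $ i)) + 1 - R
        + (\<Sum>i\<in>UNIV. k i * l $ i powr (- 1 / 4)))" by (rule ennreal_leI)
    also have "\<dots> \<le> ennreal ((\<Sum>i\<in>UNIV. coordinate_risk \<beta> (r $ i) (s $ i) (l $ i)) + 1 - R)
        + ennreal (\<Sum>i\<in>UNIV. k i * l $ i powr (- 1 / 4))" by (intro ennreal_add_le sum_nonneg mult_nonneg_nonneg k) simp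
    also have "\<dots> \<le> predictive_excess \<beta> r s q l + (\<Sum>i\<in>UNIV. ennreal (k i) * ennreal (l $ i powr (- 1 / 4)))"
      using \<beta> k by (intro add_mono kl_risk_ge_excess r s l R True)
        (auto simp: ennreal_mult'[symmetric])
    finally have "ennreal (w l) * ennreal (c + 1 - R) \<le> ennreal (w l) * (predictive_excess \<beta> r s q l
        + (\<Sum>i\<in>UNIV. ennreal (k i) * ennreal (l $ i powr (- 1 / 4))))" by (rule mult_left_mono) simp
    then show ?thesis by (simp add: distrib_left sum_distrib_left mult_ac)
  qed (simp add: w_def)
  have meas: "(\<lambda>l. ennreal (w l) * predictive_excess \<beta> r s q l) \<in> borel_measurable lborel"
    unfolding predictive_excess_def
    by (intro borel_measurable_times_ennreal borel_measurable_nn_integral_count_space) measurable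
  have "ennreal W * ennreal (c + 1 - R) = (\<integral>\<^sup>+l. ennreal (w l) * ennreal (c + 1 - R) \<partial>lborel)"
    by (simp add: nn_integral_multc int_w)
  also have "\<dots> \<le> (\<integral>\<^sup>+l. ennreal (w l) * predictive_excess \<beta> r s q l
      + (\<Sum>i\<in>UNIV. ennreal (k i) * (ennreal (w l) * ennreal (l $ i powr (- 1 / 4)))) \<partial>lborel)"
    by (intro nn_integral_mono pointwise)
  also have "\<dots> = ennreal W + (\<Sum>i\<in>UNIV. ennreal (k i) * ennreal (W * g))"
    using nn_integral_predictive_excess[OF r s less_imp_le[OF \<beta>], of q, folded w_def]
    by (subst nn_integral_add[OF meas]) (auto simp: nn_integral_sum nn_integral_cmult int_w int_w(2)[simplified])
  also have "\<dots> = ennreal W * ennreal (1 + (\<Sum>i\<in>UNIV. k i) * g)"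
  proof -
    have "(\<Sum>i\<in>UNIV. ennreal (k i) * ennreal (W * g)) = ennreal (\<Sum>i\<in>UNIV. k i * (W * g))"
      using k W g by (subst sum_ennreal[symmetric]) (auto simp: ennreal_mult')
    moreover have "(\<Sum>i\<in>UNIV. k i * (W * g)) = W * ((\<Sum>i\<in>UNIV. k i) * g)"
      by (simp add: sum_distrib_right sum_distrib_left mult_ac)
    moreover have "0 \<le> (\<Sum>i\<in>UNIV. k i) * g" using k g by (intro mult_nonneg_nonneg sum_nonneg) auto
    ultimately show ?thesis
      using W by (simp add: ennreal_mult'[symmetric] ennreal_plus[symmetric] distrib_left del: ennreal_plus)
  qed
  finally have "ennreal (c + 1 - R) \<le> ennreal (1 + (\<Sum>i\<in>UNIV. k i) * g)"
    using W by (simp add: ennreal_mult_le_mult_iff)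
  moreover have "0 \<le> (\<Sum>i\<in>UNIV. k i) * g" using k g by (intro mult_nonneg_nonneg sum_nonneg) auto
  \<comment> \<open>The right side is nonnegative, so the comparison of reals follows even where the
    left side was cut off at 0.\<close>
  ultimately have "c + 1 - R \<le> 1 + (\<Sum>i\<in>UNIV. k i) * g" by (subst (asm) ennreal_le_iff) auto
  then show ?thesis unfolding c_def k_def g_def by linarith
qed

text \<open>Negating the claim bounds the risk of q by one number ?R at all l. The resulting
  inequality holds with this same number for every \<beta> > 0, so the limit \<beta> to 0 can be
  taken in it although the prior becomes improper.\<close>

lemma ex_kl_risk_greater:
  fixes r s :: "real ^ 'n" and q :: "nat ^ 'n \<Rightarrow> (nat ^ 'n) pmf"
  assumes r: "\<And>i. 0 < r $ i" and s: "\<And>i. 0 < s $ i" and "0 < \<epsilon>"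
  shows "\<exists>l\<in>pos_orthant. kl_risk r s (\<lambda>x y. pmf (q x) y) l
    > ereal (0.5 * (\<Sum>i\<in>UNIV. ln ((r $ i + s $ i) / r $ i)) - \<epsilon>)"
proof (rule ccontr)
  let ?c = "\<lambda>\<beta>. 1 / 2 * (\<Sum>i\<in>UNIV. ln ((r $ i + s $ i + \<beta>) / (r $ i + \<beta>)))
    - (\<Sum>i\<in>UNIV. 4 * r $ i powr (- 1 / 4)) * (Gamma (1 / 4) / Gamma (1 / 2) * \<beta> powr (1 / 4))"
  let ?R = "0.5 * (\<Sum>i\<in>UNIV. ln ((r $ i + s $ i) / r $ i)) - \<epsilon>"
  assume "\<not> ?thesis"
  then have "\<And>l. l \<in> pos_orthant \<Longrightarrow> kl_risk r s (\<lambda>x y. pmf (q x) y) l \<le> ereal ?R"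
    by (auto simp: not_less)
  then have le: "?c \<beta> \<le> ?R" if "0 < \<beta>" for \<beta> using bayes_lower_bound[OF r s that] by blast
  have r0: "r $ i \<noteq> 0" "r $ i + s $ i \<noteq> 0" for i using r[of i] s[of i] by linarith+
  have t1: "((\<lambda>\<beta>. ln ((r $ i + s $ i + \<beta>) / (r $ i + \<beta>))) \<longlongrightarrow> ln ((r $ i + s $ i + 0) / (r $ i + 0))) (at_right 0)" for i
    using r0[of i] by (intro tendsto_ln tendsto_divide tendsto_add tendsto_const tendsto_ident_at) auto
  have t2: "((\<lambda>\<beta>. \<beta> powr (1 / 4)) \<longlongrightarrow> 0 powr (1 / 4)) (at_right (0 :: real))"
    by (rule tendsto_powr2[OF tendsto_ident_at tendsto_const])
      (auto simp: eventually_at_filter less_imp_le)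
  \<comment> \<open>As \<open>0 powr (1 / 4)\<close> is 0, the error disappears in the limit, and
    what remains exceeds ?R by \<epsilon>.\<close>
  have "(?c \<longlongrightarrow> 1 / 2 * (\<Sum>i\<in>UNIV. ln ((r $ i + s $ i + 0) / (r $ i + 0)))
    - (\<Sum>i\<in>UNIV. 4 * r $ i powr (- 1 / 4)) * (Gamma (1 / 4) / Gamma (1 / 2) * 0 powr (1 / 4))) (at_right 0)"
    by (intro tendsto_diff tendsto_mult tendsto_const tendsto_sum t1 t2)
  moreover have "eventually (\<lambda>\<beta>. ?c \<beta> \<le> ?R) (at_right 0)"
    using le by (auto simp: eventually_at_right_field intro: exI[of _ 1])
  ultimately have "1 / 2 * (\<Sum>i\<in>UNIV. ln ((r $ i + s $ i + 0) / (r $ i + 0)))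
    - (\<Sum>i\<in>UNIV. 4 * r $ i powr (- 1 / 4)) * (Gamma (1 / 4) / Gamma (1 / 2) * 0 powr (1 / 4)) \<le> ?R"
    by (rule tendsto_upperbound) simp
  then show False using assms(3) by simp
qed

theorem theorem3:
  fixes r s :: "real ^ 'n"
  assumes "\<And>i. 0 < r $ i" and "\<And>i. 0 < s $ i"
  shows "(\<forall>l\<in>pos_orthant. kl_risk r s (jeffreys_predictive r s) l
            < ereal (0.52 * (\<Sum>i\<in>UNIV. ln ((r $ i + s $ i) / r $ i)))) \<and>
         (\<forall>(q :: nat ^ 'n \<Rightarrow> (nat ^ 'n) pmf) (\<epsilon> :: real). 0 < \<epsilon> \<longrightarrow>
            (\<exists>l\<in>pos_orthant. kl_risk r s (\<lambda>x y. pmf (q x) y) l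
              > ereal (0.5 * (\<Sum>i\<in>UNIV. ln ((r $ i + s $ i) / r $ i)) - \<epsilon>)))"
  using kl_risk_jeffreys_less[OF assms] ex_kl_risk_greater[OF assms] by blast

end
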